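(* There is a syntactically computable function $K$ from closed System T terms $t:(\iota\to\iota)\to\iota$ to natural numbers at least two such that, for every closed System T term $t:(\iota\to\iota)\to\iota$, $$h(D(t))<\theta_{K(t)}<\varepsilon_0 ,$$ where $D(t)$ is the dialogue tree of $t$, $h$ is its classical ordinal height, $\theta_0=\omega$, $\theta_{n+1}=\omega^{\theta_n}$, and $\varepsilon_0=\sup_n\theta_n$.
   Context: Ordinals are classical, with ordinary ordinal arithmetic. "Syntactically computable" means computable from the finite syntax of the (typed) term. **System T.** Simple types: $\sigma,\tau::=\iota\mid\sigma\to\tau$ (arrows associate to the right; $\iota$ is the type of natural numbers). Terms are simply typed $\lambda$-terms (variables, abstractions $\lambda x^\sigma.t$, applications $t\,u$), up to renaming of bound variables, over the constants $\mathsf 0:\iota$, $\mathsf{succ}:\iota\to\iota$, and $\mathsf{Rec}_\sigma:(\iota\to\sigma\to\sigma)\to\sigma\to\iota\to\sigma$ for every type $\sigma$. Closed terms are terms in the empty context. **Dialogue trees.** For a set $X$, $\mathcal D(X)$ is inductively generated by leaves $\eta(x)$ ($x\in X$) and nodes $\beta_i(\varphi)$ ($i\in\mathbb N$, $\varphi:\mathbb N\to\mathcal D(X)$). Height of $d\in\mathcal D(\mathbb N)$: $h(\eta(n))=0$, $h(\beta_i(\varphi))=\sup_{n\in\mathbb N}(h(\varphi(n))+1)$. Grafting, for $d\in\mathcal D(X)$ and $g:X\to\mathcal D(Y)$: $\eta(x)\gg\!\!=g\;=\;g(x)$ and $\beta_i(\varphi)\gg\!\!=g\;=\;\beta_i(n\mapsto\varphi(n)\gg\!\!=g)$.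 Put $\mathrm{map}(f,d)=d\gg\!\!=(x\mapsto\eta(f(x)))$. **Dialogue interpretation.** $V_\iota=\mathcal D(\mathbb N)$, $V_{\sigma\to\tau}=V_\sigma\to V_\tau$ (full function space). A valuation $\gamma$ for a context $\Gamma$ assigns $\gamma(x)\in V_\sigma$ to each $x:\sigma$ in $\Gamma$. Typed grafting, for $d\in\mathcal D(X)$ and $g:X\to V_\sigma$: $d\gg\!\!=_\iota g=d\gg\!\!=g$, and $(d\gg\!\!=_{\sigma\to\tau}g)(a)=d\gg\!\!=_\tau(x\mapsto g(x)(a))$. For $\Gamma\vdash t:\sigma$, $[\![t]\!]^D_\gamma\in V_\sigma$ is defined by $[\![x]\!]^D_\gamma=\gamma(x)$; $[\![\lambda x^\sigma.t]\!]^D_\gamma(a)=[\![t]\!]^D_{\gamma[x\mapsto a]}$; $[\![t\,u]\!]^D_\gamma=[\![t]\!]^D_\gamma([\![u]\!]^D_\gamma)$; $[\![\mathsf 0]\!]^D=\eta(0)$; $[\![\mathsf{succ}]\!]^D(d)=\mathrm{map}(n\mapsto n+1,d)$; $[\![\mathsf{Rec}_\sigma]\!]^D(f)(a)(d)=d\gg\!\!=_\sigma(n\mapsto v_n)$, where $v_0=a$ and $v_{n+1}=f(\eta(n))(v_n)$. The generic input is $\mathsf{gen}:\mathcal D(\mathbb N)\to\mathcal D(\mathbb N)$, $\mathsf{gen}(d)=d\gg\!\!=(i\mapsto\beta_i(n\mapsto\eta(n)))$. For closed $t:(\iota\to\iota)\to\iota$, the dialogue tree of $t$ is $D(t)=[\![t]\!]^D(\mathsf{gen})\in\mathcal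 D(\mathbb N)$. *)

theory Defs
  imports Complex_Main "HOL-Library.Countable_Set" "HOL-Library.FuncSet" "HOL-Library.Nat_Bijection"
begin

unbundle cardinal_syntax

lemma Well_order_empty: "Well_order ({} :: 'a rel)"
  by (simp add: well_order_on_empty)

(* Ordinals as isomorphism classes of well-orders. The carriers are subsets of nat, so the type
   consists of exactly the countable ordinals; see countable_imp_bdd_above below. *)

quotient_type ordinal = "nat rel" / partial: "\<lambda>r s. r =o s"
proof (rule part_equivpI)
  show "\<exists>r :: nat rel. r =o r" using ordIso_reflexive[OF Well_order_empty] by blast
  show "symp (\<lambda>r s :: nat rel. r =o s)" by (intro sympI) (rule ordIso_symmetric)
  show "transp (\<lambda>r s :: nat rel. r =o s)" by (intro transpI) (rule ordIso_transitive)
qed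

lemma Well_order_rep: "Well_order (rep_ordinal x)"
  using Quotient3_rep_reflp[OF Quotient3_ordinal, of x] unfolding ordIso_def by blast

lemma abs_rep: "abs_ordinal (rep_ordinal x) = x"
  by (rule Quotient3_abs_rep[OF Quotient3_ordinal])

lemma rep_abs: "Well_order r \<Longrightarrow> rep_ordinal (abs_ordinal r) =o r"
  by (rule Quotient3_rep_abs[OF Quotient3_ordinal]) (rule ordIso_reflexive)

instantiation ordinal :: wellorder
begin

lift_definition less_eq_ordinal :: "ordinal \<Rightarrow> ordinal \<Rightarrow> bool" is "\<lambda>r s. r \<le>o s"
  by (meson ordIso_ordLeq_trans ordIso_symmetric ordLeq_ordIso_trans)

lift_definition less_ordinal :: "ordinal \<Rightarrow> ordinal \<Rightarrow> bool" is "\<lambda>r s. r <o s"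
  by (meson ordIso_ordLess_trans ordIso_symmetric ordLess_ordIso_trans)

lemma le_rep: "x \<le> y \<longleftrightarrow> rep_ordinal x \<le>o rep_ordinal y"
  using less_eq_ordinal.abs_eq[of "rep_ordinal x" "rep_ordinal y"]
  by (simp add: abs_rep Well_order_rep ordIso_reflexive)

lemma less_rep: "x < y \<longleftrightarrow> rep_ordinal x <o rep_ordinal y"
  using less_ordinal.abs_eq[of "rep_ordinal x" "rep_ordinal y"]
  by (simp add: abs_rep Well_order_rep ordIso_reflexive)

lemma wf_less_ordinal: "wf {(x, y :: ordinal). x < y}"
proof -
  have "{(x, y :: ordinal). x < y} = inv_image ordLess rep_ordinal"
    by (auto simp: less_rep)
  then show ?thesis using wf_inv_image[OF wf_ordLess] by simp
qed

instance
proof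
  fix x y z :: ordinal
  show "x \<le> x" by (simp add: le_rep Well_order_rep ordLeq_reflexive)
  show "x \<le> y \<Longrightarrow> y \<le> z \<Longrightarrow> x \<le> z" unfolding le_rep by (rule ordLeq_transitive)
  show "x \<le> y \<or> y \<le> x" by (simp add: le_rep Well_order_rep ordLeq_total)
  show "(x < y) = (x \<le> y \<and> \<not> y \<le> x)"
    unfolding le_rep less_rep
    using not_ordLeq_iff_ordLess[OF Well_order_rep Well_order_rep, of y x] ordLess_imp_ordLeq
    by blast
  show "x \<le> y \<Longrightarrow> y \<le> x \<Longrightarrow> x = y"
    unfolding le_rep
    using Quotient3_rel_rep[OF Quotient3_ordinal, of x y] ordIso_iff_ordLeq by blast
next
  fix P :: "ordinal \<Rightarrow> bool" and a :: ordinal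
  assume "\<And>x. (\<And>y. y < x \<Longrightarrow> P y) \<Longrightarrow> P x"
  then show "P a" using wf_induct[OF wf_less_ordinal, of P a] by blast
qed

end

instantiation ordinal :: "{conditionally_complete_linorder, order_bot}"
begin

lift_definition bot_ordinal :: ordinal is "{}"
  by (rule ordIso_reflexive[OF Well_order_empty])

definition "inf (x :: ordinal) y = min x y"
definition "sup (x :: ordinal) y = max x y"
definition "Inf X = (LEAST x :: ordinal. x \<in> X)"
definition "Sup X = (LEAST y :: ordinal. \<forall>x\<in>X. x \<le> y)"

lemma bot_le_ordinal: "bot \<le> (x :: ordinal)"
proof -
  have "rep_ordinal bot =o ({} :: nat rel)"
    unfolding bot_ordinal_def by (rule rep_abs[OF Well_order_empty])
  moreover have "({} :: nat rel) \<le>o rep_ordinal x"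
    using ordLeq_iff_ordLess_Restr[OF Well_order_empty Well_order_rep] by (simp add: Field_def)
  ultimately show ?thesis by (simp add: le_rep ordIso_ordLeq_trans)
qed

instance
proof
  fix x y z :: ordinal and X :: "ordinal set"
  show "bot \<le> x" by (rule bot_le_ordinal)
  show "inf x y \<le> x" "inf x y \<le> y" "x \<le> sup x y" "y \<le> sup x y"
    by (auto simp: inf_ordinal_def sup_ordinal_def)
  show "x \<le> y \<Longrightarrow> x \<le> z \<Longrightarrow> x \<le> inf y z" "y \<le> x \<Longrightarrow> z \<le> x \<Longrightarrow> sup y z \<le> x"
    by (auto simp: inf_ordinal_def sup_ordinal_def)
  show "x \<in> X \<Longrightarrow> bdd_below X \<Longrightarrow> Inf X \<le> x"
    by (simp add: Inf_ordinal_def Least_le)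
  show "X \<noteq> {} \<Longrightarrow> (\<And>x. x \<in> X \<Longrightarrow> z \<le> x) \<Longrightarrow> z \<le> Inf X"
    unfolding Inf_ordinal_def ex_in_conv[symmetric] by (rule LeastI2_ex)
  show "x \<in> X \<Longrightarrow> bdd_above X \<Longrightarrow> x \<le> Sup X"
    unfolding Sup_ordinal_def bdd_above_def
    by (elim exE) (drule LeastI[where P = "\<lambda>y. \<forall>x\<in>X. x \<le> y"], blast)
  show "X \<noteq> {} \<Longrightarrow> (\<And>x. x \<in> X \<Longrightarrow> x \<le> z) \<Longrightarrow> Sup X \<le> z"
    by (simp add: Sup_ordinal_def Least_le)
qed

end

lemma Restr_rep_less:
  assumes "a \<in> Field (rep_ordinal x)"
  shows "\<exists>y<x. Restr (rep_ordinal x) (underS (rep_ordinal x) a) =o rep_ordinal y"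
proof -
  let ?s = "Restr (rep_ordinal x) (underS (rep_ordinal x) a)"
  have "Well_order ?s" by (rule Well_order_Restr[OF Well_order_rep])
  then have eq: "?s =o rep_ordinal (abs_ordinal ?s)" by (rule ordIso_symmetric[OF rep_abs])
  moreover have "?s <o rep_ordinal x"
    using assms by (intro underS_Restr_ordLess Well_order_rep) auto
  ultimately have "rep_ordinal (abs_ordinal ?s) <o rep_ordinal x"
    by (rule ordIso_ordLess_trans[OF ordIso_symmetric])
  then have "abs_ordinal ?s < x" by (simp add: less_rep)
  with eq show ?thesis by blast
qed

lemma countable_lessThan_ordinal: "countable {..<x :: ordinal}"
proof -
  let ?g = "\<lambda>a. abs_ordinal (Restr (rep_ordinal x) (underS (rep_ordinal x) a))"
  have "y \<in> range ?g" if y: "y < x" for y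
  proof -
    obtain a where "rep_ordinal y =o Restr (rep_ordinal x) (underS (rep_ordinal x) a)"
      by (rule bexE[OF y[unfolded less_rep
            ordLess_iff_ordIso_Restr[OF Well_order_rep Well_order_rep]]])
    then have "abs_ordinal (rep_ordinal y) = ?g a"
      by (intro Quotient3_rel_abs[OF Quotient3_ordinal])
    then show ?thesis by (auto simp: abs_rep)
  qed
  then have "{..<x} \<subseteq> range ?g" by blast
  then show ?thesis by (rule countable_subset) simp
qed

lemma uncountable_UNIV_ordinal: "uncountable (UNIV :: ordinal set)"
proof
  assume "countable (UNIV :: ordinal set)"
  then obtain f :: "ordinal \<Rightarrow> nat" where inj: "inj f" by (auto simp: countable_def)
  define S where "S = {(x, y :: ordinal). x \<le> y}"
  have Field_S: "Field S = UNIV" by (auto simp: S_def Field_def)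
  have "S - Id = {(x, y). x < y}" by (auto simp: S_def)
  then have "wf (S - Id)" using wf_less_ordinal by simp
  moreover have "refl S" "trans S" "antisym S" "total S"
    by (auto simp: S_def refl_on_def trans_def antisym_def total_on_def)
  ultimately have wS: "Well_order S"
    by (simp add: Field_S well_order_on_def linear_order_on_def
        partial_order_on_def preorder_on_def)
  define R where "R = dir_image S f"
  have SR: "S =o R" and wR: "Well_order R"
    using dir_image_ordIso[OF wS] Well_order_dir_image[OF wS] inj
    by (auto simp: R_def Field_S)
  have uS: "underS S x = {..<x}" for x by (auto simp: underS_def S_def)
  have filt: "wo_rel.ofilter S {..<x}" for x
    using wo_rel.underS_ofilter[OF wo_rel.intro[OF wS], of x] by (simp add: uS)
  have le: "rep_ordinal x \<le>o Restr S {..<x}" for x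
  proof (induction x rule: less_induct)
    case (less x)
    have "Restr (rep_ordinal x) (underS (rep_ordinal x) a) <o Restr S {..<x}"
      if a: "a \<in> Field (rep_ordinal x)" for a
    proof -
      obtain y where y: "y < x" and
        eq: "Restr (rep_ordinal x) (underS (rep_ordinal x) a) =o rep_ordinal y"
        using Restr_rep_less[OF a] by blast
      have "{..<y} \<subset> {..<x}" using y by auto
      then have "Restr S {..<y} <o Restr S {..<x}"
        using ofilter_subset_ordLess[OF wS filt filt] by blast
      with ordIso_ordLeq_trans[OF eq less.IH[OF y]] show ?thesis
        by (rule ordLeq_ordLess_trans)
    qed
    then show ?case
      using ordLeq_iff_ordLess_Restr[OF Well_order_rep Well_order_Restr[OF wS]] by blast
  qed
  let ?x = "abs_ordinal R"
  have "Restr S {..<?x} <o S"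
    using underS_Restr_ordLess[OF wS, of ?x] by (simp add: Field_S uS)
  with le have "rep_ordinal ?x <o S" by (rule ordLeq_ordLess_trans)
  moreover have "rep_ordinal ?x =o S"
    using rep_abs[OF wR] ordIso_symmetric[OF SR] by (rule ordIso_transitive)
  ultimately show False using not_ordLess_ordIso by blast
qed

(* So Sup, left unspecified on unbounded sets, is the supremum on every countable set of ordinals. *)

lemma countable_imp_bdd_above:
  assumes "countable (A :: ordinal set)"
  shows "bdd_above A"
proof (rule ccontr)
  assume "\<not> bdd_above A"
  then have "\<exists>a\<in>A. x < a" for x by (auto simp: bdd_above_def not_le)
  then have "UNIV = (\<Union>a\<in>A. {..<a})" by blast
  then show False
    using uncountable_UNIV_ordinal assms countable_lessThan_ordinal by (metis countable_UN)
qed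

definition osucc :: "ordinal \<Rightarrow> ordinal" where
  "osucc x = (LEAST y. x < y)"

lemma less_osucc: "x < osucc x"
proof -
  have "\<exists>y. x < y"
  proof (rule ccontr)
    assume "\<nexists>y. x < y"
    then have "UNIV = {..<x} \<union> {x}" by (auto simp: not_less le_less)
    then show False
      using uncountable_UNIV_ordinal countable_lessThan_ordinal[of x]
      by (metis countable_Un countable_finite finite.emptyI finite.insertI)
  qed
  then show ?thesis unfolding osucc_def by (auto intro: LeastI)
qed

lemma osucc_le_iff: "osucc x \<le> y \<longleftrightarrow> x < y"
  using less_osucc[of x] by (auto simp: osucc_def intro: Least_le)

lemma osucc_inject [simp]: "osucc x = osucc y \<longleftrightarrow> x = y"
  by (metis less_osucc not_less osucc_le_iff order.antisym less_imp_le linorder_cases)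

definition opred :: "ordinal \<Rightarrow> ordinal" where
  "opred x = (THE y. x = osucc y)"

lemma opred_osucc [simp]: "opred (osucc x) = x"
  by (simp add: opred_def)

function ordinal_add :: "ordinal \<Rightarrow> ordinal \<Rightarrow> ordinal" where
  "ordinal_add x y =
    (if y = bot then x
     else if \<exists>z. y = osucc z then osucc (ordinal_add x (opred y))
     else (SUP z\<in>{..<y}. ordinal_add x z))"
  by pat_completeness auto
termination
  by (relation "inv_image {(x, y). x < y} snd") (auto simp: wf_less_ordinal less_osucc)

declare ordinal_add.simps [simp del]

instantiation ordinal :: "{zero, one, plus}"
begin
definition "0 = (bot :: ordinal)"
definition "1 = osucc 0"
definition "x + y = ordinal_add x y"
instance ..
end

function ordinal_mult :: "ordinal \<Rightarrow> ordinal \<Rightarrow> ordinal" where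
  "ordinal_mult x y =
    (if y = 0 then 0
     else if \<exists>z. y = osucc z then ordinal_mult x (opred y) + x
     else (SUP z\<in>{..<y}. ordinal_mult x z))"
  by pat_completeness auto
termination
  by (relation "inv_image {(x, y). x < y} snd") (auto simp: wf_less_ordinal less_osucc)

declare ordinal_mult.simps [simp del]

instantiation ordinal :: times
begin
definition "x * y = ordinal_mult x y"
instance ..
end

definition omega :: ordinal where
  "omega = (SUP n. (osucc ^^ n) 0)"

function omega_pow :: "ordinal \<Rightarrow> ordinal" where
  "omega_pow y =
    (if y = 0 then 1
     else if \<exists>z. y = osucc z then omega_pow (opred y) * omega
     else (SUP z\<in>{..<y}. omega_pow z))"
  by pat_completeness auto
termination
  by (relation "{(x, y). x < y}") (auto simp: wf_less_ordinal less_osucc)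

declare omega_pow.simps [simp del]

lemma osucc_neq_0 [simp]: "osucc x \<noteq> 0"
  using less_osucc[of x] bot_le_ordinal[of x] by (auto simp: zero_ordinal_def)

lemma ordinal_add_rec:
  "x + 0 = (x :: ordinal)"
  "x + osucc z = osucc (x + z)"
  "y \<noteq> 0 \<Longrightarrow> \<nexists>z. y = osucc z \<Longrightarrow> x + y = (SUP z\<in>{..<y}. x + z)"
  using osucc_neq_0 unfolding plus_ordinal_def zero_ordinal_def
  by (subst ordinal_add.simps; auto)+

lemma ordinal_mult_rec:
  "x * 0 = (0 :: ordinal)"
  "x * osucc z = x * z + x"
  "y \<noteq> 0 \<Longrightarrow> \<nexists>z. y = osucc z \<Longrightarrow> x * y = (SUP z\<in>{..<y}. x * z)"
  unfolding times_ordinal_def by (subst ordinal_mult.simps; auto)+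

lemma omega_pow_rec:
  "omega_pow 0 = 1"
  "omega_pow (osucc z) = omega_pow z * omega"
  "y \<noteq> 0 \<Longrightarrow> \<nexists>z. y = osucc z \<Longrightarrow> omega_pow y = (SUP z\<in>{..<y}. omega_pow z)"
  by (subst omega_pow.simps; auto)+

primrec theta :: "nat \<Rightarrow> ordinal" where
  "theta 0 = omega"
| "theta (Suc n) = omega_pow (theta n)"

definition epsilon_0 :: ordinal where
  "epsilon_0 = (SUP n. theta n)"

datatype 'x dtree = Eta 'x | Beta nat "nat \<Rightarrow> 'x dtree"

primrec height :: "nat dtree \<Rightarrow> ordinal" where
  "height (Eta n) = 0"
| "height (Beta i \<phi>) = (SUP n. height (\<phi> n) + 1)"

primrec graft :: "'x dtree \<Rightarrow> ('x \<Rightarrow> 'y dtree) \<Rightarrow> 'y dtree" where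
  "graft (Eta x) g = g x"
| "graft (Beta i \<phi>) g = Beta i (\<lambda>n. graft (\<phi> n) g)"

definition dmap :: "('x \<Rightarrow> 'y) \<Rightarrow> 'x dtree \<Rightarrow> 'y dtree" where
  "dmap f d = graft d (\<lambda>x. Eta (f x))"

definition gen :: "nat dtree \<Rightarrow> nat dtree" where
  "gen d = graft d (\<lambda>i. Beta i Eta)"

datatype ty = Iota (\<open>\<iota>\<close>) | Fun ty ty (infixr \<open>\<^bold>\<rightarrow>\<close> 65)

(* De Bruijn indices represent terms up to renaming of bound variables. *)

datatype tm = Var nat | Lam ty tm | App tm tm | Zero | Succ | Rec ty

inductive has_type :: "ty list \<Rightarrow> tm \<Rightarrow> ty \<Rightarrow> bool" where
  Var: "i < length \<Gamma> \<Longrightarrow> has_type \<Gamma> (Var i) (\<Gamma> ! i)"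
| Lam: "has_type (\<sigma> # \<Gamma>) t \<tau> \<Longrightarrow> has_type \<Gamma> (Lam \<sigma> t) (\<sigma> \<^bold>\<rightarrow> \<tau>)"
| App: "has_type \<Gamma> t (\<sigma> \<^bold>\<rightarrow> \<tau>) \<Longrightarrow> has_type \<Gamma> u \<sigma> \<Longrightarrow> has_type \<Gamma> (App t u) \<tau>"
| Zero: "has_type \<Gamma> Zero \<iota>"
| Succ: "has_type \<Gamma> Succ (\<iota> \<^bold>\<rightarrow> \<iota>)"
| Rec: "has_type \<Gamma> (Rec \<sigma>) ((\<iota> \<^bold>\<rightarrow> \<sigma> \<^bold>\<rightarrow> \<sigma>) \<^bold>\<rightarrow> \<sigma> \<^bold>\<rightarrow> \<iota> \<^bold>\<rightarrow> \<sigma>)"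

definition closed_functionals :: "tm set" where
  "closed_functionals = {t. has_type [] t ((\<iota> \<^bold>\<rightarrow> \<iota>) \<^bold>\<rightarrow> \<iota>)}"

(* In the mathematical definition, Iota is interpreted by the dialogue trees over nat and each
   function type by a full function space. Jointly over all simple types these sets are larger than
   every type definable in HOL, so no single HOL function interprets all terms in them. Below, val
   has names for just those elements that the clauses of the interpretation produce (closures,
   partially applied recursors, graftings at function types); interprets and vapp are the clauses
   for terms and the clauses for applying the named functions. The theorem dialogue_tree_full
   shows that the resulting tree is the one obtained from the full function spaces, for every HOL
   type that has room for the spaces at the finitely many types occurring in the given term. *)

datatype val =
    Tree "nat dtree"
  | Clo tm "val list"
  | SuccV
  | RecV ty
  | RecV1 ty val
  | RecV2 ty val val
  | GraftV ty "nat dtree" "nat \<Rightarrow> val"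
  | GenV

primrec (nonexhaustive) tree_of :: "val \<Rightarrow> nat dtree" where
  "tree_of (Tree d) = d"

(* GraftV \<tau> d g names the function mapping a to the grafting at type \<tau> of n \<mapsto> g n a onto d. *)

primrec vgraft :: "ty \<Rightarrow> nat dtree \<Rightarrow> (nat \<Rightarrow> val) \<Rightarrow> val" where
  "vgraft \<iota> d g = Tree (graft d (\<lambda>n. tree_of (g n)))"
| "vgraft (\<sigma> \<^bold>\<rightarrow> \<tau>) d g = GraftV \<tau> d g"

inductive interprets :: "val list \<Rightarrow> tm \<Rightarrow> val \<Rightarrow> bool"
  and vapp :: "val \<Rightarrow> val \<Rightarrow> val \<Rightarrow> bool"
where
  Var: "i < length \<gamma> \<Longrightarrow> interprets \<gamma> (Var i) (\<gamma> ! i)"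
| Lam: "interprets \<gamma> (Lam \<sigma> t) (Clo t \<gamma>)"
| App: "interprets \<gamma> t f \<Longrightarrow> interprets \<gamma> u a \<Longrightarrow> vapp f a b \<Longrightarrow> interprets \<gamma> (App t u) b"
| Zero: "interprets \<gamma> Zero (Tree (Eta 0))"
| Succ: "interprets \<gamma> Succ SuccV"
| Rec: "interprets \<gamma> (Rec \<sigma>) (RecV \<sigma>)"
| Clo: "interprets (a # \<gamma>) t b \<Longrightarrow> vapp (Clo t \<gamma>) a b"
| SuccV: "vapp SuccV (Tree d) (Tree (dmap Suc d))"
| RecV: "vapp (RecV \<sigma>) f (RecV1 \<sigma> f)"
| RecV1: "vapp (RecV1 \<sigma> f) a (RecV2 \<sigma> f a)"
| RecV2: "v 0 = a \<Longrightarrow> (\<And>n. vapp f (Tree (Eta n)) (w n)) \<Longrightarrow> (\<And>n. vapp (w n) (v n) (v (Suc n)))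
    \<Longrightarrow> vapp (RecV2 \<sigma> f a) (Tree d) (vgraft \<sigma> d v)"
| GraftV: "(\<And>n. vapp (g n) a (h n)) \<Longrightarrow> vapp (GraftV \<tau> d g) a (vgraft \<tau> d h)"
| GenV: "vapp GenV (Tree d) (Tree (gen d))"

definition has_dialogue_tree :: "tm \<Rightarrow> nat dtree \<Rightarrow> bool" where
  "has_dialogue_tree t d \<longleftrightarrow> (\<exists>f. interprets [] t f \<and> vapp f GenV (Tree d))"

definition dialogue_tree :: "tm \<Rightarrow> nat dtree" where
  "dialogue_tree t = (THE d. has_dialogue_tree t d)"

lemma interprets_vapp_unique:
  "interprets \<gamma> t x \<Longrightarrow> interprets \<gamma> t y \<Longrightarrow> x = y"
  "vapp f a x \<Longrightarrow> vapp f a y \<Longrightarrow> x = y"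
proof (induction \<gamma> t x and f a x arbitrary: y and y rule: interprets_vapp.inducts)
  case (App \<gamma> t f u a b)
  from App.prems show ?case by (cases rule: interprets.cases) (use App.IH in blast)
next
  case (Clo a \<gamma> t b)
  from Clo.prems show ?case by (cases rule: vapp.cases) (use Clo.IH in blast)
next
  case (RecV2 v a f w \<sigma> d)
  from RecV2.prems obtain v' w' where y: "y = vgraft \<sigma> d v'" and v': "v' 0 = a"
    and w': "\<And>n. vapp f (Tree (Eta n)) (w' n)" "\<And>n. vapp (w' n) (v' n) (v' (Suc n))"
    by (cases rule: vapp.cases) blast
  have "v n = v' n" for n
  proof (induction n)
    case 0
    show ?case using RecV2.hyps v' by simp
  next
    case (Suc n)
    then show ?case using RecV2.IH w' by metis
  qed
  then show ?case using y by (simp add: ext[of v v'])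
next
  case (GraftV g a h \<tau> d)
  from GraftV.prems obtain h' where y: "y = vgraft \<tau> d h'" and h': "\<And>n. vapp (g n) a (h' n)"
    by (cases rule: vapp.cases) blast
  have "h = h'" using GraftV.IH h' by blast
  then show ?case using y by simp
qed (auto elim: interprets.cases vapp.cases)

lemma dialogue_tree_eqI: "has_dialogue_tree t d \<Longrightarrow> dialogue_tree t = d"
  unfolding dialogue_tree_def has_dialogue_tree_def
  by (rule the_equality) (use interprets_vapp_unique in blast)+

primrec red :: "ty \<Rightarrow> val \<Rightarrow> bool" where
  "red \<iota> v \<longleftrightarrow> (\<exists>d. v = Tree d)"
| "red (\<sigma> \<^bold>\<rightarrow> \<tau>) v \<longleftrightarrow> (\<forall>a. red \<sigma> a \<longrightarrow> (\<exists>b. vapp v a b \<and> red \<tau> b))"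

lemma red_vgraft: "(\<And>n. red \<sigma> (g n)) \<Longrightarrow> red \<sigma> (vgraft \<sigma> d g)"
proof (induction \<sigma> arbitrary: g)
  case (Fun \<sigma> \<tau>)
  have "\<exists>b. vapp (GraftV \<tau> d g) a b \<and> red \<tau> b" if "red \<sigma> a" for a
  proof -
    have "\<forall>n. \<exists>b. vapp (g n) a b \<and> red \<tau> b" using Fun.prems that by simp
    then obtain h where "\<forall>n. vapp (g n) a (h n) \<and> red \<tau> (h n)" by metis
    then show ?thesis using Fun.IH(2) by (blast intro: interprets_vapp.GraftV)
  qed
  then show ?case by simp
qed simp

lemma red_RecV: "red ((\<iota> \<^bold>\<rightarrow> \<sigma> \<^bold>\<rightarrow> \<sigma>) \<^bold>\<rightarrow> \<sigma> \<^bold>\<rightarrow> \<iota> \<^bold>\<rightarrow> \<sigma>) (RecV \<sigma>)"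
proof -
  have "\<exists>b. vapp (RecV2 \<sigma> f a) (Tree d) b \<and> red \<sigma> b"
    if f: "red (\<iota> \<^bold>\<rightarrow> \<sigma> \<^bold>\<rightarrow> \<sigma>) f" and a: "red \<sigma> a" for f a d
  proof -
    have "\<forall>n. \<exists>b. vapp f (Tree (Eta n)) b \<and> red (\<sigma> \<^bold>\<rightarrow> \<sigma>) b" using f by simp
    then obtain w where w: "\<And>n. vapp f (Tree (Eta n)) (w n)" "\<And>n. red (\<sigma> \<^bold>\<rightarrow> \<sigma>) (w n)" by metis
    have "\<exists>v. v 0 = a \<and> (\<forall>n. red \<sigma> (v n) \<and> vapp (w n) (v n) (v (Suc n)))"
    proof -
      have "\<forall>n x. \<exists>y. red \<sigma> x \<longrightarrow> vapp (w n) x y \<and> red \<sigma> y" using w(2) by auto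
      then obtain s where s: "\<And>n x. red \<sigma> x \<Longrightarrow> vapp (w n) x (s n x) \<and> red \<sigma> (s n x)" by metis
      have "red \<sigma> (rec_nat a s n)" for n using a s by (induction n) auto
      then show ?thesis using s by (intro exI[of _ "rec_nat a s"]) simp
    qed
    then obtain v where "v 0 = a" "\<And>n. red \<sigma> (v n)" "\<And>n. vapp (w n) (v n) (v (Suc n))" by blast
    then show ?thesis using w(1) red_vgraft by (blast intro: interprets_vapp.RecV2)
  qed
  then have *: "red (\<iota> \<^bold>\<rightarrow> \<sigma>) (RecV2 \<sigma> f a)"
    if "red (\<iota> \<^bold>\<rightarrow> \<sigma> \<^bold>\<rightarrow> \<sigma>) f" "red \<sigma> a" for f a
    using that by (metis red.simps)
  then have "red (\<sigma> \<^bold>\<rightarrow> \<iota> \<^bold>\<rightarrow> \<sigma>) (RecV1 \<sigma> f)" if "red (\<iota> \<^bold>\<rightarrow> \<sigma> \<^bold>\<rightarrow> \<sigma>) f" for f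
    using that interprets_vapp.RecV1 by (metis red.simps(2))
  then show ?thesis
    using interprets_vapp.RecV by (metis red.simps(2))
qed

lemma red_interprets:
  "has_type \<Gamma> t \<sigma> \<Longrightarrow> list_all2 red \<Gamma> \<gamma> \<Longrightarrow> \<exists>v. interprets \<gamma> t v \<and> red \<sigma> v"
proof (induction arbitrary: \<gamma> rule: has_type.induct)
  case (Var i \<Gamma>)
  then show ?case by (metis interprets_vapp.Var list_all2_conv_all_nth)
next
  case (Lam \<sigma> \<Gamma> t \<tau>)
  have "\<exists>b. vapp (Clo t \<gamma>) a b \<and> red \<tau> b" if "red \<sigma> a" for a
    using Lam.IH[of "a # \<gamma>"] Lam.prems that by (auto intro: interprets_vapp.Clo)
  then show ?case by (auto intro: interprets_vapp.Lam)
next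
  case (App \<Gamma> t \<sigma> \<tau> u)
  from App.IH(1)[OF App.prems] obtain f
    where f: "interprets \<gamma> t f" "\<And>a. red \<sigma> a \<Longrightarrow> \<exists>b. vapp f a b \<and> red \<tau> b" by auto
  from App.IH(2)[OF App.prems] obtain a where a: "interprets \<gamma> u a" "red \<sigma> a" by blast
  from f(2)[OF a(2)] obtain b where "vapp f a b" "red \<tau> b" by blast
  then show ?case using f(1) a(1) interprets_vapp.App by blast
next
  case (Rec \<Gamma> \<sigma>)
  show ?case using red_RecV interprets_vapp.Rec by blast
next
  case (Zero \<Gamma>)
  show ?case using interprets_vapp.Zero by (intro exI conjI) auto
next
  case (Succ \<Gamma>)
  show ?case using interprets_vapp.Succ interprets_vapp.SuccV by (intro exI conjI) auto
qed

lemma has_dialogue_tree_dialogue_tree: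
  assumes "t \<in> closed_functionals"
  shows "has_dialogue_tree t (dialogue_tree t)"
proof -
  have "red (\<iota> \<^bold>\<rightarrow> \<iota>) GenV" by (auto intro: interprets_vapp.GenV)
  moreover obtain f where "interprets [] t f" "red ((\<iota> \<^bold>\<rightarrow> \<iota>) \<^bold>\<rightarrow> \<iota>) f"
    using red_interprets[of "[]" t _ "[]"] assms unfolding closed_functionals_def by blast
  ultimately obtain d where "has_dialogue_tree t d"
    unfolding has_dialogue_tree_def by (metis red.simps)
  then show ?thesis using dialogue_tree_eqI by simp
qed

primrec type_of :: "tm \<Rightarrow> ty list \<Rightarrow> ty" where
  "type_of (Var i) \<Gamma> = \<Gamma> ! i"
| "type_of (Lam \<sigma> t) \<Gamma> = \<sigma> \<^bold>\<rightarrow> type_of t (\<sigma> # \<Gamma>)"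
| "type_of (App t u) \<Gamma> = (case type_of t \<Gamma> of \<sigma> \<^bold>\<rightarrow> \<tau> \<Rightarrow> \<tau> | \<iota> \<Rightarrow> \<iota>)"
| "type_of Zero \<Gamma> = \<iota>"
| "type_of Succ \<Gamma> = \<iota> \<^bold>\<rightarrow> \<iota>"
| "type_of (Rec \<sigma>) \<Gamma> = (\<iota> \<^bold>\<rightarrow> \<sigma> \<^bold>\<rightarrow> \<sigma>) \<^bold>\<rightarrow> \<sigma> \<^bold>\<rightarrow> \<iota> \<^bold>\<rightarrow> \<sigma>"

lemma type_of_has_type: "has_type \<Gamma> t \<sigma> \<Longrightarrow> type_of t \<Gamma> = \<sigma>"
  by (induction rule: has_type.induct) auto

primrec subterm_types :: "tm \<Rightarrow> ty list \<Rightarrow> ty set" where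
  "subterm_types (Var i) \<Gamma> = {type_of (Var i) \<Gamma>}"
| "subterm_types (Lam \<sigma> t) \<Gamma> = insert (type_of (Lam \<sigma> t) \<Gamma>) (subterm_types t (\<sigma> # \<Gamma>))"
| "subterm_types (App t u) \<Gamma> =
    insert (type_of (App t u) \<Gamma>) (subterm_types t \<Gamma> \<union> subterm_types u \<Gamma>)"
| "subterm_types Zero \<Gamma> = {type_of Zero \<Gamma>}"
| "subterm_types Succ \<Gamma> = {type_of Succ \<Gamma>}"
| "subterm_types (Rec \<sigma>) \<Gamma> = {type_of (Rec \<sigma>) \<Gamma>}"

lemma type_of_in_subterm_types: "type_of t \<Gamma> \<in> subterm_types t \<Gamma>"
  by (cases t) auto

(* V is the full type structure over the types in T, coded in a HOL type 'u: at function types,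
   ap identifies V with the set of all functions between the component sets. *)

locale full_type_structure =
  fixes T :: "ty set" and V :: "ty \<Rightarrow> 'u set"
    and tree :: "nat dtree \<Rightarrow> 'u" and ap :: "'u \<Rightarrow> 'u \<Rightarrow> 'u"
  assumes T_components: "\<sigma> \<^bold>\<rightarrow> \<tau> \<in> T \<Longrightarrow> \<sigma> \<in> T \<and> \<tau> \<in> T"
    and V_Iota: "bij_betw tree UNIV (V \<iota>)"
    and V_Fun: "\<sigma> \<^bold>\<rightarrow> \<tau> \<in> T \<Longrightarrow>
      bij_betw (\<lambda>f. restrict (ap f) (V \<sigma>)) (V (\<sigma> \<^bold>\<rightarrow> \<tau>)) (V \<sigma> \<rightarrow>\<^sub>E V \<tau>)"
begin

definition untree :: "'u \<Rightarrow> nat dtree" where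
  "untree x = inv tree x"

definition fn :: "ty \<Rightarrow> ty \<Rightarrow> ('u \<Rightarrow> 'u) \<Rightarrow> 'u" where
  "fn \<sigma> \<tau> F = (THE f. f \<in> V (\<sigma> \<^bold>\<rightarrow> \<tau>) \<and> (\<forall>a\<in>V \<sigma>. ap f a = F a))"

primrec typed_graft :: "ty \<Rightarrow> nat dtree \<Rightarrow> (nat \<Rightarrow> 'u) \<Rightarrow> 'u" where
  "typed_graft \<iota> d g = tree (graft d (\<lambda>n. untree (g n)))"
| "typed_graft (\<sigma> \<^bold>\<rightarrow> \<tau>) d g = fn \<sigma> \<tau> (\<lambda>a. typed_graft \<tau> d (\<lambda>n. ap (g n) a))"

primrec interp :: "tm \<Rightarrow> ty list \<Rightarrow> 'u list \<Rightarrow> 'u" where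
  "interp (Var i) \<Gamma> \<gamma> = \<gamma> ! i"
| "interp (Lam \<sigma> t) \<Gamma> \<gamma> = fn \<sigma> (type_of t (\<sigma> # \<Gamma>)) (\<lambda>a. interp t (\<sigma> # \<Gamma>) (a # \<gamma>))"
| "interp (App t u) \<Gamma> \<gamma> = ap (interp t \<Gamma> \<gamma>) (interp u \<Gamma> \<gamma>)"
| "interp Zero \<Gamma> \<gamma> = tree (Eta 0)"
| "interp Succ \<Gamma> \<gamma> = fn \<iota> \<iota> (\<lambda>x. tree (dmap Suc (untree x)))"
| "interp (Rec \<sigma>) \<Gamma> \<gamma> =
    fn (\<iota> \<^bold>\<rightarrow> \<sigma> \<^bold>\<rightarrow> \<sigma>) (\<sigma> \<^bold>\<rightarrow> \<iota> \<^bold>\<rightarrow> \<sigma>) (\<lambda>f. fn \<sigma> (\<iota> \<^bold>\<rightarrow> \<sigma>) (\<lambda>a. fn \<iota> \<sigma> (\<lambda>x.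
      typed_graft \<sigma> (untree x) (rec_nat a (\<lambda>n v. ap (ap f (tree (Eta n))) v)))))"

definition full_dialogue_tree :: "tm \<Rightarrow> nat dtree" where
  "full_dialogue_tree t = untree (ap (interp t [] []) (fn \<iota> \<iota> (\<lambda>x. tree (gen (untree x)))))"

lemma untree_tree [simp]: "untree (tree d) = d"
  using V_Iota by (simp add: untree_def bij_betw_def)

lemma tree_in: "tree d \<in> V \<iota>"
  using V_Iota by (auto simp: bij_betw_def)

lemma V_IotaE: "x \<in> V \<iota> \<Longrightarrow> (\<And>d. x = tree d \<Longrightarrow> P) \<Longrightarrow> P"
  using V_Iota by (auto simp: bij_betw_def)

lemma ap_in:
  assumes "\<sigma> \<^bold>\<rightarrow> \<tau> \<in> T" "f \<in> V (\<sigma> \<^bold>\<rightarrow> \<tau>)" "a \<in> V \<sigma>"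
  shows "ap f a \<in> V \<tau>"
proof -
  have "restrict (ap f) (V \<sigma>) \<in> V \<sigma> \<rightarrow>\<^sub>E V \<tau>"
    using bij_betwE[OF V_Fun[OF assms(1)]] assms(2) by blast
  then show ?thesis using assms(3) by (metis PiE_mem restrict_apply')
qed

lemma fn_props:
  assumes "\<sigma> \<^bold>\<rightarrow> \<tau> \<in> T" "\<And>a. a \<in> V \<sigma> \<Longrightarrow> F a \<in> V \<tau>"
  shows "fn \<sigma> \<tau> F \<in> V (\<sigma> \<^bold>\<rightarrow> \<tau>) \<and> (\<forall>a\<in>V \<sigma>. ap (fn \<sigma> \<tau> F) a = F a)"
  unfolding fn_def
proof (rule theI')
  have b: "bij_betw (\<lambda>f. restrict (ap f) (V \<sigma>)) (V (\<sigma> \<^bold>\<rightarrow> \<tau>)) (V \<sigma> \<rightarrow>\<^sub>E V \<tau>)"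
    using V_Fun[OF assms(1)] .
  have "restrict F (V \<sigma>) \<in> V \<sigma> \<rightarrow>\<^sub>E V \<tau>" using assms(2) by auto
  then obtain f where f: "f \<in> V (\<sigma> \<^bold>\<rightarrow> \<tau>)" "restrict F (V \<sigma>) = restrict (ap f) (V \<sigma>)"
    using bij_betw_imp_surj_on[OF b] by (metis (no_types, lifting) imageE)
  show "\<exists>!f. f \<in> V (\<sigma> \<^bold>\<rightarrow> \<tau>) \<and> (\<forall>a\<in>V \<sigma>. ap f a = F a)"
  proof (rule ex1I)
    show "f \<in> V (\<sigma> \<^bold>\<rightarrow> \<tau>) \<and> (\<forall>a\<in>V \<sigma>. ap f a = F a)"
      using f by (metis restrict_apply')
    fix g assume g: "g \<in> V (\<sigma> \<^bold>\<rightarrow> \<tau>) \<and> (\<forall>a\<in>V \<sigma>. ap g a = F a)"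
    then have "restrict (ap g) (V \<sigma>) = restrict (ap f) (V \<sigma>)"
      unfolding f(2)[symmetric] by (intro restrict_ext) auto
    then show "g = f" using b g f(1) unfolding bij_betw_def inj_on_def by blast
  qed
qed

lemma typed_graft_in:
  "\<sigma> \<in> T \<Longrightarrow> (\<And>n. g n \<in> V \<sigma>) \<Longrightarrow> typed_graft \<sigma> d g \<in> V \<sigma>"
proof (induction \<sigma> arbitrary: g)
  case (Fun \<sigma> \<tau>)
  have "typed_graft \<tau> d (\<lambda>n. ap (g n) a) \<in> V \<tau>" if "a \<in> V \<sigma>" for a
    by (intro Fun.IH(2) ap_in[OF Fun.prems(1) Fun.prems(2) that])
      (use Fun.prems(1) T_components in blast)
  then show ?case using fn_props Fun.prems(1) by simp
qed (simp add: tree_in)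

lemma rec_nat_in:
  assumes "\<iota> \<^bold>\<rightarrow> \<sigma> \<^bold>\<rightarrow> \<sigma> \<in> T" "f \<in> V (\<iota> \<^bold>\<rightarrow> \<sigma> \<^bold>\<rightarrow> \<sigma>)" "a \<in> V \<sigma>"
  shows "rec_nat a (\<lambda>n v. ap (ap f (tree (Eta n))) v) n \<in> V \<sigma>"
proof (induction n)
  case (Suc n)
  then show ?case
    using ap_in[OF _ ap_in[OF assms(1,2) tree_in]] T_components[OF assms(1)] by simp
qed (simp add: assms)

lemma interp_Rec:
  assumes T: "(\<iota> \<^bold>\<rightarrow> \<sigma> \<^bold>\<rightarrow> \<sigma>) \<^bold>\<rightarrow> \<sigma> \<^bold>\<rightarrow> \<iota> \<^bold>\<rightarrow> \<sigma> \<in> T" (is "?\<rho> \<in> T")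
  shows "interp (Rec \<sigma>) \<Gamma> \<gamma> \<in> V ?\<rho>"
    and "f \<in> V (\<iota> \<^bold>\<rightarrow> \<sigma> \<^bold>\<rightarrow> \<sigma>) \<Longrightarrow> a \<in> V \<sigma> \<Longrightarrow>
      ap (ap (ap (interp (Rec \<sigma>) \<Gamma> \<gamma>) f) a) (tree d) =
      typed_graft \<sigma> d (rec_nat a (\<lambda>n v. ap (ap f (tree (Eta n))) v))"
proof -
  let ?v = "\<lambda>f a. rec_nat a (\<lambda>n v. ap (ap f (tree (Eta n))) v)"
  let ?F3 = "\<lambda>f a x. typed_graft \<sigma> (untree x) (?v f a)"
  let ?F2 = "\<lambda>f a. fn \<iota> \<sigma> (?F3 f a)"
  let ?F1 = "\<lambda>f. fn \<sigma> (\<iota> \<^bold>\<rightarrow> \<sigma>) (?F2 f)"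
  have T': "\<iota> \<^bold>\<rightarrow> \<sigma> \<^bold>\<rightarrow> \<sigma> \<in> T" "\<sigma> \<^bold>\<rightarrow> \<iota> \<^bold>\<rightarrow> \<sigma> \<in> T" "\<iota> \<^bold>\<rightarrow> \<sigma> \<in> T" "\<sigma> \<in> T"
    using T T_components by blast+
  have 3: "?F2 f a \<in> V (\<iota> \<^bold>\<rightarrow> \<sigma>) \<and> (\<forall>x\<in>V \<iota>. ap (?F2 f a) x = ?F3 f a x)"
    if "f \<in> V (\<iota> \<^bold>\<rightarrow> \<sigma> \<^bold>\<rightarrow> \<sigma>)" "a \<in> V \<sigma>" for f a
    by (intro fn_props T' typed_graft_in rec_nat_in that)
  have 2: "?F1 f \<in> V (\<sigma> \<^bold>\<rightarrow> \<iota> \<^bold>\<rightarrow> \<sigma>) \<and> (\<forall>a\<in>V \<sigma>. ap (?F1 f) a = ?F2 f a)"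
    if "f \<in> V (\<iota> \<^bold>\<rightarrow> \<sigma> \<^bold>\<rightarrow> \<sigma>)" for f
    by (intro fn_props T' 3[THEN conjunct1] that)
  have 1: "interp (Rec \<sigma>) \<Gamma> \<gamma> \<in> V ?\<rho> \<and>
      (\<forall>f\<in>V (\<iota> \<^bold>\<rightarrow> \<sigma> \<^bold>\<rightarrow> \<sigma>). ap (interp (Rec \<sigma>) \<Gamma> \<gamma>) f = ?F1 f)"
    unfolding interp.simps by (intro fn_props T 2[THEN conjunct1])
  then show "interp (Rec \<sigma>) \<Gamma> \<gamma> \<in> V ?\<rho>" by blast
  show "ap (ap (ap (interp (Rec \<sigma>) \<Gamma> \<gamma>) f) a) (tree d) = typed_graft \<sigma> d (?v f a)"
    if "f \<in> V (\<iota> \<^bold>\<rightarrow> \<sigma> \<^bold>\<rightarrow> \<sigma>)" "a \<in> V \<sigma>"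
    using 1 2 3 that tree_in untree_tree by metis
qed

lemma interp_in:
  "has_type \<Gamma> t \<sigma> \<Longrightarrow> subterm_types t \<Gamma> \<subseteq> T \<Longrightarrow> list_all2 (\<lambda>\<sigma> x. x \<in> V \<sigma>) \<Gamma> \<gamma> \<Longrightarrow>
    interp t \<Gamma> \<gamma> \<in> V \<sigma>"
proof (induction arbitrary: \<gamma> rule: has_type.induct)
  case (Var i \<Gamma>)
  then show ?case by (simp add: list_all2_conv_all_nth)
next
  case (Lam \<sigma> \<Gamma> t \<tau>)
  have [simp]: "type_of t (\<sigma> # \<Gamma>) = \<tau>" using Lam.hyps type_of_has_type by blast
  show ?case using Lam by (auto intro!: fn_props[THEN conjunct1])
next
  case (App \<Gamma> t \<sigma> \<tau> u)
  have "\<sigma> \<^bold>\<rightarrow> \<tau> \<in> T"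
    using App.prems(1) type_of_in_subterm_types[of t \<Gamma>] type_of_has_type[OF App.hyps(1)] by auto
  then show ?case using App by (auto intro: ap_in)
next
  case (Succ \<Gamma>)
  then show ?case by (auto intro!: fn_props[THEN conjunct1] tree_in)
next
  case (Rec \<Gamma> \<sigma>)
  show ?case by (rule interp_Rec(1)) (use Rec in simp)
qed (simp add: tree_in)

primrec rel :: "ty \<Rightarrow> val \<Rightarrow> 'u \<Rightarrow> bool" where
  "rel \<iota> v x \<longleftrightarrow> (\<exists>d. v = Tree d \<and> x = tree d)"
| "rel (\<sigma> \<^bold>\<rightarrow> \<tau>) v x \<longleftrightarrow> x \<in> V (\<sigma> \<^bold>\<rightarrow> \<tau>) \<and>
    (\<forall>a y. rel \<sigma> a y \<longrightarrow> (\<exists>b. vapp v a b \<and> rel \<tau> b (ap x y)))"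

lemma rel_in: "rel \<sigma> v x \<Longrightarrow> x \<in> V \<sigma>"
  by (cases \<sigma>) (auto simp: tree_in)

lemma rel_vgraft:
  "\<sigma> \<in> T \<Longrightarrow> (\<And>n. rel \<sigma> (g n) (x n)) \<Longrightarrow> rel \<sigma> (vgraft \<sigma> d g) (typed_graft \<sigma> d x)"
proof (induction \<sigma> arbitrary: g x)
  case Iota
  have "tree_of (g n) = untree (x n)" for n using Iota.prems(2)[of n] by auto
  then show ?case by simp
next
  case (Fun \<sigma> \<tau>)
  have T: "\<sigma> \<in> T" "\<tau> \<in> T" using T_components[OF Fun.prems(1)] by auto
  have x: "x n \<in> V (\<sigma> \<^bold>\<rightarrow> \<tau>)" for n using Fun.prems(2) by simp
  have in_V: "typed_graft \<tau> d (\<lambda>n. ap (x n) y) \<in> V \<tau>" if "y \<in> V \<sigma>" for y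
    using that by (intro typed_graft_in T ap_in[OF Fun.prems(1)] x)
  have f: "typed_graft (\<sigma> \<^bold>\<rightarrow> \<tau>) d x \<in> V (\<sigma> \<^bold>\<rightarrow> \<tau>) \<and>
      (\<forall>y\<in>V \<sigma>. ap (typed_graft (\<sigma> \<^bold>\<rightarrow> \<tau>) d x) y = typed_graft \<tau> d (\<lambda>n. ap (x n) y))"
    unfolding typed_graft.simps by (rule fn_props[OF Fun.prems(1) in_V])
  have "\<exists>b. vapp (GraftV \<tau> d g) a b \<and> rel \<tau> b (ap (typed_graft (\<sigma> \<^bold>\<rightarrow> \<tau>) d x) y)"
    if ay: "rel \<sigma> a y" for a y
  proof -
    have "\<forall>n. \<exists>b. vapp (g n) a b \<and> rel \<tau> b (ap (x n) y)" using Fun.prems(2) ay by simp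
    then obtain h where h: "\<And>n. vapp (g n) a (h n)" "\<And>n. rel \<tau> (h n) (ap (x n) y)" by metis
    have "rel \<tau> (vgraft \<tau> d h) (typed_graft \<tau> d (\<lambda>n. ap (x n) y))"
      by (rule Fun.IH(2)[OF T(2) h(2)])
    moreover have "vapp (GraftV \<tau> d g) a (vgraft \<tau> d h)" by (rule interprets_vapp.GraftV[OF h(1)])
    ultimately show ?thesis using f rel_in[OF ay] by auto
  qed
  then show ?case using f by simp
qed

lemma rel_RecV:
  assumes T: "(\<iota> \<^bold>\<rightarrow> \<sigma> \<^bold>\<rightarrow> \<sigma>) \<^bold>\<rightarrow> \<sigma> \<^bold>\<rightarrow> \<iota> \<^bold>\<rightarrow> \<sigma> \<in> T" (is "?\<rho> \<in> T")
  shows "rel ?\<rho> (RecV \<sigma>) (interp (Rec \<sigma>) \<Gamma> \<gamma>)"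
proof -
  let ?r = "interp (Rec \<sigma>) \<Gamma> \<gamma>"
  note r = interp_Rec[OF T, where \<Gamma> = \<Gamma> and \<gamma> = \<gamma>]
  have T': "\<iota> \<^bold>\<rightarrow> \<sigma> \<^bold>\<rightarrow> \<sigma> \<in> T" "\<sigma> \<^bold>\<rightarrow> \<iota> \<^bold>\<rightarrow> \<sigma> \<in> T" "\<iota> \<^bold>\<rightarrow> \<sigma> \<in> T" "\<sigma> \<in> T"
    using T T_components by blast+
  have base: "\<exists>b. vapp (RecV2 \<sigma> f a) (Tree d) b \<and> rel \<sigma> b (ap (ap (ap ?r x) y) (tree d))"
    if f: "rel (\<iota> \<^bold>\<rightarrow> \<sigma> \<^bold>\<rightarrow> \<sigma>) f x" and a: "rel \<sigma> a y" for f x a y d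
  proof -
    have "\<forall>n. \<exists>b. vapp f (Tree (Eta n)) b \<and> rel (\<sigma> \<^bold>\<rightarrow> \<sigma>) b (ap x (tree (Eta n)))"
      using f by simp
    then obtain w where w: "\<And>n. vapp f (Tree (Eta n)) (w n)"
      "\<And>n. rel (\<sigma> \<^bold>\<rightarrow> \<sigma>) (w n) (ap x (tree (Eta n)))" by metis
    have "\<forall>n u. \<exists>u'. \<forall>z. rel \<sigma> u z \<longrightarrow> vapp (w n) u u' \<and> rel \<sigma> u' (ap (ap x (tree (Eta n))) z)"
    proof (intro allI)
      fix n u
      show "\<exists>u'. \<forall>z. rel \<sigma> u z \<longrightarrow> vapp (w n) u u' \<and> rel \<sigma> u' (ap (ap x (tree (Eta n))) z)"
      proof (cases "\<exists>z. rel \<sigma> u z")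
        case True
        then obtain u' where u': "vapp (w n) u u'" using w(2)[of n] by auto
        have "rel \<sigma> u' (ap (ap x (tree (Eta n))) z)" if "rel \<sigma> u z" for z
        proof -
          obtain u'' where "vapp (w n) u u''" "rel \<sigma> u'' (ap (ap x (tree (Eta n))) z)"
            using w(2)[of n] \<open>rel \<sigma> u z\<close> by auto
          then show ?thesis using interprets_vapp_unique(2)[OF u'] by blast
        qed
        then show ?thesis using u' by blast
      qed blast
    qed
    then obtain s where s: "\<And>n u z. rel \<sigma> u z \<Longrightarrow>
        vapp (w n) u (s n u) \<and> rel \<sigma> (s n u) (ap (ap x (tree (Eta n))) z)" by metis
    let ?v = "rec_nat a s" and ?z = "rec_nat y (\<lambda>n v. ap (ap x (tree (Eta n))) v)"
    have v: "rel \<sigma> (?v n) (?z n)" for n using a s by (induction n) auto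
    then have "vapp (w n) (?v n) (?v (Suc n))" for n using s by auto
    then have "vapp (RecV2 \<sigma> f a) (Tree d) (vgraft \<sigma> d ?v)"
      using w(1) by (intro interprets_vapp.RecV2) auto
    moreover have "rel \<sigma> (vgraft \<sigma> d ?v) (typed_graft \<sigma> d ?z)" by (rule rel_vgraft[OF T'(4) v])
    ultimately show ?thesis using r(2)[OF rel_in[OF f] rel_in[OF a]] by auto
  qed
  have "rel (\<iota> \<^bold>\<rightarrow> \<sigma>) (RecV2 \<sigma> f a) (ap (ap ?r x) y)"
    if f: "rel (\<iota> \<^bold>\<rightarrow> \<sigma> \<^bold>\<rightarrow> \<sigma>) f x" and a: "rel \<sigma> a y" for f x a y
    using base[OF that] ap_in[OF T'(2) ap_in[OF T r(1) rel_in[OF f]] rel_in[OF a]] by auto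
  then have "rel (\<sigma> \<^bold>\<rightarrow> \<iota> \<^bold>\<rightarrow> \<sigma>) (RecV1 \<sigma> f) (ap ?r x)"
    if f: "rel (\<iota> \<^bold>\<rightarrow> \<sigma> \<^bold>\<rightarrow> \<sigma>) f x" for f x
    using that interprets_vapp.RecV1 ap_in[OF T r(1) rel_in[OF f]] by (metis rel.simps(2))
  then show ?thesis
    using interprets_vapp.RecV r(1) by (metis rel.simps(2))
qed

lemma rel_interp:
  "has_type \<Gamma> t \<sigma> \<Longrightarrow> subterm_types t \<Gamma> \<subseteq> T \<Longrightarrow>
    length \<gamma> = length \<Gamma> \<Longrightarrow> length \<delta> = length \<Gamma> \<Longrightarrow>
    (\<And>i. i < length \<Gamma> \<Longrightarrow> rel (\<Gamma> ! i) (\<gamma> ! i) (\<delta> ! i)) \<Longrightarrow>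
    \<exists>v. interprets \<gamma> t v \<and> rel \<sigma> v (interp t \<Gamma> \<delta>)"
proof (induction arbitrary: \<gamma> \<delta> rule: has_type.induct)
  case (Var i \<Gamma>)
  then have "interprets \<gamma> (Var i) (\<gamma> ! i)" by (intro interprets_vapp.Var) simp
  then show ?case using Var by auto
next
  case (Lam \<sigma> \<Gamma> t \<tau>)
  have ty: "type_of t (\<sigma> # \<Gamma>) = \<tau>" using Lam.hyps type_of_has_type by blast
  have T: "\<sigma> \<^bold>\<rightarrow> \<tau> \<in> T" "subterm_types t (\<sigma> # \<Gamma>) \<subseteq> T" using Lam.prems(1) ty by auto
  have "list_all2 (\<lambda>\<sigma> x. x \<in> V \<sigma>) \<Gamma> \<delta>"
    using Lam.prems(2,3) rel_in[OF Lam.prems(4)] by (simp add: list_all2_conv_all_nth)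
  then have "interp t (\<sigma> # \<Gamma>) (x # \<delta>) \<in> V \<tau>" if "x \<in> V \<sigma>" for x
    using that by (intro interp_in[OF Lam.hyps T(2)]) simp
  then have f: "interp (Lam \<sigma> t) \<Gamma> \<delta> \<in> V (\<sigma> \<^bold>\<rightarrow> \<tau>) \<and>
      (\<forall>x\<in>V \<sigma>. ap (interp (Lam \<sigma> t) \<Gamma> \<delta>) x = interp t (\<sigma> # \<Gamma>) (x # \<delta>))"
    unfolding interp.simps ty by (rule fn_props[OF T(1)])
  have "\<exists>b. vapp (Clo t \<gamma>) a b \<and> rel \<tau> b (ap (interp (Lam \<sigma> t) \<Gamma> \<delta>) x)"
    if ax: "rel \<sigma> a x" for a x
  proof -
    have "rel ((\<sigma> # \<Gamma>) ! i) ((a # \<gamma>) ! i) ((x # \<delta>) ! i)" if "i < length (\<sigma> # \<Gamma>)" for i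
      using that ax Lam.prems(4) by (cases i) auto
    then obtain b where "interprets (a # \<gamma>) t b" "rel \<tau> b (interp t (\<sigma> # \<Gamma>) (x # \<delta>))"
      using Lam.IH[OF T(2), of "a # \<gamma>" "x # \<delta>"] Lam.prems by auto
    then show ?thesis using f rel_in[OF ax] interprets_vapp.Clo[of a \<gamma> t b] by metis
  qed
  then have "rel (\<sigma> \<^bold>\<rightarrow> \<tau>) (Clo t \<gamma>) (interp (Lam \<sigma> t) \<Gamma> \<delta>)" using f by (metis rel.simps(2))
  then show ?case using interprets_vapp.Lam by blast
next
  case (App \<Gamma> t \<sigma> \<tau> u)
  have "subterm_types t \<Gamma> \<subseteq> T" "subterm_types u \<Gamma> \<subseteq> T" using App.prems(1) by auto
  then obtain f a where f: "interprets \<gamma> t f" "rel (\<sigma> \<^bold>\<rightarrow> \<tau>) f (interp t \<Gamma> \<delta>)"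
    and a: "interprets \<gamma> u a" "rel \<sigma> a (interp u \<Gamma> \<delta>)"
    using App.IH(1)[OF _ App.prems(2-4)] App.IH(2)[OF _ App.prems(2-4)] by meson
  obtain b where "vapp f a b" "rel \<tau> b (ap (interp t \<Gamma> \<delta>) (interp u \<Gamma> \<delta>))"
    using f(2) a(2) by auto
  then show ?case using f(1) a(1) interprets_vapp.App by (metis interp.simps(3))
next
  case (Zero \<Gamma>)
  show ?case using interprets_vapp.Zero by (intro exI conjI) auto
next
  case (Succ \<Gamma>)
  have "interp Succ \<Gamma> \<delta> \<in> V (\<iota> \<^bold>\<rightarrow> \<iota>) \<and>
      (\<forall>x\<in>V \<iota>. ap (interp Succ \<Gamma> \<delta>) x = tree (dmap Suc (untree x)))"
    unfolding interp.simps using Succ.prems(1) by (intro fn_props tree_in) auto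
  then have "interp Succ \<Gamma> \<delta> \<in> V (\<iota> \<^bold>\<rightarrow> \<iota>)"
    "ap (interp Succ \<Gamma> \<delta>) (tree d) = tree (dmap Suc d)" for d
    using tree_in by auto
  then have "rel (\<iota> \<^bold>\<rightarrow> \<iota>) SuccV (interp Succ \<Gamma> \<delta>)"
    unfolding rel.simps using interprets_vapp.SuccV by auto
  then show ?case using interprets_vapp.Succ by blast
next
  case (Rec \<Gamma> \<sigma>)
  have "rel ((\<iota> \<^bold>\<rightarrow> \<sigma> \<^bold>\<rightarrow> \<sigma>) \<^bold>\<rightarrow> \<sigma> \<^bold>\<rightarrow> \<iota> \<^bold>\<rightarrow> \<sigma>) (RecV \<sigma>) (interp (Rec \<sigma>) \<Gamma> \<delta>)"
    by (rule rel_RecV) (use Rec.prems(1) in simp)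
  then show ?case using interprets_vapp.Rec by blast
qed

theorem dialogue_tree_full:
  assumes "t \<in> closed_functionals" "subterm_types t [] \<subseteq> T"
  shows "full_dialogue_tree t = dialogue_tree t"
proof -
  have ty: "has_type [] t ((\<iota> \<^bold>\<rightarrow> \<iota>) \<^bold>\<rightarrow> \<iota>)" using assms(1) by (simp add: closed_functionals_def)
  then have "(\<iota> \<^bold>\<rightarrow> \<iota>) \<^bold>\<rightarrow> \<iota> \<in> T"
    using type_of_has_type type_of_in_subterm_types assms(2) by (metis subsetD)
  then have T: "\<iota> \<^bold>\<rightarrow> \<iota> \<in> T" using T_components by blast
  let ?G = "fn \<iota> \<iota> (\<lambda>x. tree (gen (untree x)))"
  have "?G \<in> V (\<iota> \<^bold>\<rightarrow> \<iota>) \<and> (\<forall>x\<in>V \<iota>. ap ?G x = tree (gen (untree x)))"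
    by (intro fn_props T tree_in)
  then have "?G \<in> V (\<iota> \<^bold>\<rightarrow> \<iota>)" "ap ?G (tree d) = tree (gen d)" for d
    using tree_in by auto
  then have G: "rel (\<iota> \<^bold>\<rightarrow> \<iota>) GenV ?G"
    unfolding rel.simps using interprets_vapp.GenV by auto
  obtain f where f: "interprets [] t f" "rel ((\<iota> \<^bold>\<rightarrow> \<iota>) \<^bold>\<rightarrow> \<iota>) f (interp t [] [])"
    using rel_interp[OF ty assms(2), of "[]" "[]"] by auto
  then obtain d where "vapp f GenV (Tree d)" "ap (interp t [] []) ?G = tree d"
    using G unfolding rel.simps(2)[of "\<iota> \<^bold>\<rightarrow> \<iota>"] rel.simps(1) by blast
  then show ?thesis
    using f(1) dialogue_tree_eqI[of t d] unfolding has_dialogue_tree_def full_dialogue_tree_def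
    by auto
qed

end

primrec ty_code :: "ty \<Rightarrow> nat" where
  "ty_code \<iota> = 0"
| "ty_code (\<sigma> \<^bold>\<rightarrow> \<tau>) = Suc (prod_encode (ty_code \<sigma>, ty_code \<tau>))"

primrec tm_code :: "tm \<Rightarrow> nat" where
  "tm_code (Var i) = prod_encode (0, i)"
| "tm_code (Lam \<sigma> t) = prod_encode (1, prod_encode (ty_code \<sigma>, tm_code t))"
| "tm_code (App t u) = prod_encode (2, prod_encode (tm_code t, tm_code u))"
| "tm_code Zero = prod_encode (3, 0)"
| "tm_code Succ = prod_encode (4, 0)"
| "tm_code (Rec \<sigma>) = prod_encode (5, ty_code \<sigma>)"

datatype recfun = RZero | RSucc | RProj nat | RComp recfun "recfun list"
  | RPrim recfun recfun | RMin recfun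

(* evaluates f xs y: the partial recursive function denoted by f is defined at xs with value y. *)

inductive evaluates :: "recfun \<Rightarrow> nat list \<Rightarrow> nat \<Rightarrow> bool" where
  RZero: "evaluates RZero xs 0"
| RSucc: "evaluates RSucc [x] (Suc x)"
| RProj: "i < length xs \<Longrightarrow> evaluates (RProj i) xs (xs ! i)"
| RComp: "list_all2 (\<lambda>g y. evaluates g xs y) gs ys \<Longrightarrow> evaluates f ys z
    \<Longrightarrow> evaluates (RComp f gs) xs z"
| RPrim_0: "evaluates f xs y \<Longrightarrow> evaluates (RPrim f g) (0 # xs) y"
| RPrim_Suc: "evaluates (RPrim f g) (n # xs) y \<Longrightarrow> evaluates g (n # y # xs) z
    \<Longrightarrow> evaluates (RPrim f g) (Suc n # xs) z"
| RMin: "evaluates f (n # xs) 0 \<Longrightarrow> (\<And>m. m < n \<Longrightarrow> \<exists>k. evaluates f (m # xs) (Suc k))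
    \<Longrightarrow> evaluates (RMin f) xs n"

lemma evaluates_unique: "evaluates f xs y \<Longrightarrow> evaluates f xs z \<Longrightarrow> y = z"
proof (induction arbitrary: z rule: evaluates.induct)
  case (RComp xs gs ys f y)
  from RComp.prems obtain ys' where ys': "list_all2 (\<lambda>g y. evaluates g xs y) gs ys'"
    and z: "evaluates f ys' z" by (cases rule: evaluates.cases) blast
  have "ys ! i = ys' ! i" if "i < length gs" for i
    using RComp.IH(1) ys' that unfolding list_all2_conv_all_nth by metis
  then have "ys = ys'"
    using list_all2_lengthD[OF RComp.IH(1)] list_all2_lengthD[OF ys'] by (simp add: list_eq_iff_nth_eq)
  then show ?case using RComp.IH(2) z by blast
next
  case (RPrim_Suc f g n xs y w)
  from RPrim_Suc.prems obtain y' where "evaluates (RPrim f g) (n # xs) y'"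
    "evaluates g (n # y' # xs) z" by (cases rule: evaluates.cases) blast
  then show ?case using RPrim_Suc.IH by blast
next
  case (RMin f n xs)
  from RMin.prems have z: "evaluates f (z # xs) 0 \<and> (\<forall>m<z. \<exists>k. evaluates f (m # xs) (Suc k))"
    by (cases rule: evaluates.cases) blast
  show ?case
  proof (rule linorder_cases[of n z])
    assume "n < z"
    then obtain k where "evaluates f (n # xs) (Suc k)" using z by blast
    then have "0 = Suc k" by (rule RMin.IH(1))
    then show ?thesis by simp
  next
    assume "z < n"
    then obtain k where "\<forall>y. evaluates f (z # xs) y \<longrightarrow> Suc k = y" using RMin.IH(2) by blast
    then have "Suc k = 0" using z by blast
    then show ?thesis by simp
  qed
next
  case (RPrim_0 f xs y g)
  from RPrim_0.prems show ?case by (cases rule: evaluates.cases) (rule RPrim_0.IH)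
next
  case (RZero xs)
  then show ?case by (cases rule: evaluates.cases) simp
next
  case (RSucc x)
  then show ?case by (cases rule: evaluates.cases) simp
next
  case (RProj i xs)
  from RProj.prems show ?case by (cases rule: evaluates.cases) simp
qed

definition computable_on :: "tm set \<Rightarrow> (tm \<Rightarrow> nat) \<Rightarrow> bool" where
  "computable_on A K \<longleftrightarrow> (\<exists>f. \<forall>t\<in>A. evaluates f [tm_code t] (K t))"

end

theory Submission
  imports Defs
begin

text \<open>
  Following Howard, functionals are bounded by vectors of ordinals. Application of a functional
  with vector \<open>f\<close> to an argument of type level \<open>m\<close> with vector \<open>a\<close> gets the
  vector with components \<open>max f\<^sub>i a\<^sub>i + \<omega>\<^bsup>c\<^esup>\<close> for \<open>i \<le> m\<close>, where \<open>c\<close> is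
  its own component \<open>i + 1\<close>, and \<open>f\<^sub>i\<close> for \<open>i > m\<close>. A tree is bounded by a vector
  if its height is at most \<open>\<omega>\<close> to the component \<open>0\<close>, and a functional if it maps
  bounded arguments to suitably bounded values. The vector \<open>(1, 1, \<dots>)\<close> bounds all
  constants, the recursors included.

  No abstraction operator on vectors is needed: the vector of an open term is one that becomes a
  bound after application to the vectors of the environment, so an abstraction has the vector
  of its body. For an application, combining the two vectors at a level \<open>N\<close> above all types in
  the term leaves enough room for applying both parts to the environment first and to each other
  afterwards. Hence the component \<open>i\<close> of the vector of any term stays below \<open>\<theta>\<close> of
  \<open>N + 1 - i\<close>, and the number of exponentials depends on the type levels only. These are at most
  the code of the term, so a translate of the code serves as \<open>K\<close>.
\<close>

section \<open>Ordinal arithmetic\<close>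

lemma zero_le_ordinal [simp]: "0 \<le> (x :: ordinal)"
  by (simp add: zero_ordinal_def bot_le_ordinal)

lemma not_less_zero_ordinal [simp]: "\<not> x < (0 :: ordinal)"
  by (simp add: not_less)

lemma less_osucc_iff: "x < osucc y \<longleftrightarrow> x \<le> y"
  by (metis not_less osucc_le_iff)

text \<open>\<open>Sup\<close> is meaningful only on bounded sets; initial segments are countable,
  so their images are bounded.\<close>

lemma bdd_above_image_lessThan [simp]: "bdd_above (f ` {..<x :: ordinal} :: ordinal set)"
  by (intro countable_imp_bdd_above countable_image countable_lessThan_ordinal)

lemma bdd_above_range_nat [simp]: "bdd_above (range (f :: nat \<Rightarrow> ordinal))"
  by (intro countable_imp_bdd_above) simp

lemma lessThan_ordinal_nonempty: "y \<noteq> 0 \<Longrightarrow> {..<y :: ordinal} \<noteq> {}"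
  using order.not_eq_order_implies_strict[of 0 y] by auto

lemma ordinal_induct [case_names zero succ limit]:
  assumes "P 0" "\<And>y. P y \<Longrightarrow> P (osucc y)"
    and "\<And>y. y \<noteq> 0 \<Longrightarrow> \<nexists>z. y = osucc z \<Longrightarrow> (\<And>z. z < y \<Longrightarrow> P z) \<Longrightarrow> P y"
  shows "P (y :: ordinal)"
proof (induction y rule: less_induct)
  case (less y)
  then show ?case using assms less_osucc by metis
qed

section \<open>Limit ordinals and addition\<close>

lemma osucc_less_limit: "\<nexists>z. y = osucc z \<Longrightarrow> z < y \<Longrightarrow> osucc z < y"
  by (metis le_less osucc_le_iff)

text \<open>The limit cases below treat addition in this existential form instead of through
  \<open>SUP\<close>.\<close>

lemma less_limit_add_iff:
  assumes "y \<noteq> 0" "\<nexists>z. y = osucc z"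
  shows "u < x + y \<longleftrightarrow> (\<exists>z<y. u < x + z)"
  unfolding ordinal_add_rec(3)[OF assms]
  by (subst less_cSUP_iff) (use lessThan_ordinal_nonempty assms in auto)

lemma add_less_mono_right: "y < z \<Longrightarrow> x + y < x + (z :: ordinal)"
proof (induction z rule: ordinal_induct)
  case (succ z)
  then show ?case by (metis less_osucc less_osucc_iff le_less less_trans ordinal_add_rec(2))
next
  case (limit z)
  then show ?case
    by (metis less_limit_add_iff less_osucc osucc_less_limit)
qed simp

lemma add_le_mono_right: "y \<le> z \<Longrightarrow> x + y \<le> x + (z :: ordinal)"
  by (metis add_less_mono_right le_less)

lemma add_le_mono_left: "x \<le> x' \<Longrightarrow> x + y \<le> x' + (y :: ordinal)"
proof (induction y rule: ordinal_induct)
  case (succ y)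
  then show ?case by (metis less_osucc_iff order_le_less_trans ordinal_add_rec(2) osucc_le_iff)
next
  case (limit y)
  show ?case
  proof (rule ccontr)
    assume "\<not> x + y \<le> x' + y"
    then obtain z where "z < y" "x' + y < x + z"
      using less_limit_add_iff[OF limit(1,2)] by (auto simp: not_le)
    then show False
      using limit(3)[OF _ limit(4), of z] add_less_mono_right[of z y x'] by simp
  qed
qed (simp add: ordinal_add_rec)

lemma ordinal_eqI: "(\<And>u. u < x \<longleftrightarrow> u < (y :: ordinal)) \<Longrightarrow> x = y"
  by (metis less_irrefl linorder_cases)

lemma zero_add_ordinal: "0 + y = (y :: ordinal)"
proof (induction y rule: ordinal_induct)
  case (limit y)
  show ?case
  proof (rule ordinal_eqI)
    fix u
    show "u < 0 + y \<longleftrightarrow> u < y"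
      unfolding less_limit_add_iff[OF limit(1,2)]
      using limit(3) less_osucc osucc_less_limit[OF limit(2)] by (metis less_trans)
  qed
qed (simp_all add: ordinal_add_rec)

lemma le_add_left: "y \<le> x + (y :: ordinal)"
  using add_le_mono_left[of 0 x y] by (simp add: zero_add_ordinal)

lemma ordinal_add_mono: "x \<le> x' \<Longrightarrow> y \<le> y' \<Longrightarrow> x + y \<le> x' + (y' :: ordinal)"
  using add_le_mono_left add_le_mono_right order_trans by blast

lemma ordinal_add_less_mono: "x \<le> x' \<Longrightarrow> y < y' \<Longrightarrow> x + y < x' + (y' :: ordinal)"
  using add_le_mono_left add_less_mono_right order_le_less_trans by blast

lemma ordinal_add_neq_0: "y \<noteq> 0 \<Longrightarrow> x + y \<noteq> (0 :: ordinal)"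
  using add_less_mono_right[of 0 y x] zero_le_ordinal[of y] by (metis le_less not_less_zero_ordinal)

lemma ordinal_le_imp_add: "c \<le> x \<Longrightarrow> \<exists>y. x = c + (y :: ordinal)"
proof (induction x rule: ordinal_induct)
  case zero
  then show ?case using ordinal_add_rec(1) by (metis order.antisym zero_le_ordinal)
next
  case (succ x)
  then show ?case by (metis le_less less_osucc_iff ordinal_add_rec(1,2))
next
  case (limit x)
  \<comment> \<open>Minimality of \<open>y\<close> gives \<open>c + z < x\<close> for all
    \<open>z < y\<close>. This passes to \<open>c + y \<le> x\<close> at successors and limits; for
    \<open>y = 0\<close> the premise suffices.\<close>
  define y where "y = (LEAST y. x \<le> c + y)"
  have "\<exists>y. x \<le> c + y" using le_add_left by blast
  then have le: "x \<le> c + y" unfolding y_def by (rule LeastI_ex)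
  have less: "c + z < x" if "z < y" for z using not_less_Least that unfolding y_def by (metis not_le)
  have "c + y \<le> x"
  proof (cases "y = 0 \<or> (\<exists>z. y = osucc z)")
    case True
    then show ?thesis using less less_osucc limit.prems by (auto simp: ordinal_add_rec osucc_le_iff)
  next
    case False
    then show ?thesis
      using less_limit_add_iff[of y x c] less by (metis less_asym not_le)
  qed
  then show ?case using le by auto
qed

lemma ordinal_add_assoc: "x + y + z = x + (y + z :: ordinal)"
proof (induction z rule: ordinal_induct)
  case (limit z)
  have nz: "y + z \<noteq> 0" using limit by (simp add: ordinal_add_neq_0)
  \<comment> \<open>The sum \<open>y + z\<close> is again a limit: a predecessor \<open>w\<close>
    would lie below some \<open>y + v\<close> with \<open>v < z\<close>, forcing
    \<open>y + z \<le> y + v\<close>.\<close>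
  have ns: "\<nexists>w. y + z = osucc w"
  proof
    assume "\<exists>w. y + z = osucc w"
    then obtain w where w: "y + z = osucc w" ..
    then obtain v where "v < z" "w < y + v"
      using less_limit_add_iff[OF limit(1,2)] less_osucc by metis
    then show False
      using add_less_mono_right[of v z y] w by (simp add: less_osucc_iff)
  qed
  show ?case
  proof (rule ordinal_eqI)
    fix u
    have "u < x + y + z \<longleftrightarrow> (\<exists>v<z. u < x + (y + v))"
      using limit by (auto simp: less_limit_add_iff)
    also have "\<dots> \<longleftrightarrow> (\<exists>w<y + z. u < x + w)"
    proof
      assume "\<exists>w<y + z. u < x + w"
      then obtain w v where "u < x + w" "v < z" "w < y + v"
        using less_limit_add_iff[OF limit(1,2)] by blast
      then show "\<exists>v<z. u < x + (y + v)"
        using add_less_mono_right[of w "y + v" x] less_trans by blast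
    qed (use add_less_mono_right in blast)
    finally show "u < x + y + z \<longleftrightarrow> u < x + (y + z)"
      using less_limit_add_iff[OF nz ns] by simp
  qed
qed (simp_all add: ordinal_add_rec)

section \<open>Omega and its powers\<close>

lemma less_omega_iff: "x < omega \<longleftrightarrow> (\<exists>n. x = (osucc ^^ n) 0)"
proof
  assume "x < omega"
  then obtain n where "x < (osucc ^^ n) 0" unfolding omega_def by (subst (asm) less_cSUP_iff) auto
  then show "\<exists>n. x = (osucc ^^ n) 0"
    by (induction n) (auto simp: less_osucc_iff le_less)
next
  assume "\<exists>n. x = (osucc ^^ n) 0"
  then obtain n where "x = (osucc ^^ n) 0" ..
  then have "x < (osucc ^^ Suc n) 0" by (simp add: less_osucc)
  also have "\<dots> \<le> omega" unfolding omega_def by (intro cSUP_upper) auto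
  finally show "x < omega" .
qed

lemma omega_limit: "omega \<noteq> 0" "\<nexists>z. omega = osucc z"
proof -
  show "omega \<noteq> 0" using less_omega_iff[of 0] funpow_0 by (metis not_less_zero_ordinal)
  show "\<nexists>z. omega = osucc z"
    by (metis funpow.simps(2) comp_apply less_irrefl less_omega_iff less_osucc)
qed

lemma less_mult_omega_iff: "u < x * omega \<longleftrightarrow> (\<exists>n. u < x * (osucc ^^ n) 0)"
  unfolding ordinal_mult_rec(3)[OF omega_limit]
  by (subst less_cSUP_iff)
    (use lessThan_ordinal_nonempty omega_limit(1) less_omega_iff in auto)

text \<open>The finite case of left distributivity, used to add ordinals below
  \<open>omega_pow (osucc z)\<close>.\<close>

lemma mult_funpow_osucc_add:
  "x * (osucc ^^ m) 0 + x * (osucc ^^ n) 0 = x * (osucc ^^ (n + m)) 0"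
  by (induction n) (simp_all add: ordinal_add_rec ordinal_mult_rec flip: ordinal_add_assoc)

lemma less_omega_pow_limit_iff:
  "y \<noteq> 0 \<Longrightarrow> \<nexists>z. y = osucc z \<Longrightarrow> u < omega_pow y \<longleftrightarrow> (\<exists>z<y. u < omega_pow z)"
  by (subst omega_pow_rec(3), assumption, assumption, subst less_cSUP_iff)
    (use lessThan_ordinal_nonempty in auto)

lemma omega_pow_less_osucc:
  assumes "0 < omega_pow y"
  shows "omega_pow y < omega_pow (osucc y)"
proof -
  have "omega_pow y < omega_pow y + omega_pow y"
    using add_less_mono_right[OF assms, of "omega_pow y"] by (simp add: ordinal_add_rec)
  also have "\<dots> = omega_pow y * (osucc ^^ 2) 0"
    by (simp add: ordinal_mult_rec zero_add_ordinal numeral_2_eq_2)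
  finally show ?thesis using less_mult_omega_iff by (auto simp: omega_pow_rec)
qed

lemma omega_pow_pos [simp]: "0 < omega_pow y"
proof (induction y rule: ordinal_induct)
  case (succ y)
  then show ?case using omega_pow_less_osucc less_trans by blast
next
  case (limit y)
  then show ?case using less_omega_pow_limit_iff by (metis not_less_zero_ordinal linorder_cases)
qed (simp add: omega_pow_rec one_ordinal_def less_osucc)

lemma omega_pow_strict_mono: "x < y \<Longrightarrow> omega_pow x < omega_pow y"
proof (induction y rule: ordinal_induct)
  case (succ y)
  then show ?case by (metis omega_pow_less_osucc omega_pow_pos le_less less_osucc_iff less_trans)
next
  case (limit y)
  then show ?case by (metis less_omega_pow_limit_iff less_osucc osucc_less_limit)
qed simp

lemma omega_pow_mono: "x \<le> y \<Longrightarrow> omega_pow x \<le> omega_pow y"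
  by (metis le_less omega_pow_strict_mono)

text \<open>Additive indecomposability. At a successor both summands lie below finite multiples of
  the previous power, and multipliers add up; at a limit they lie below a common smaller
  power.\<close>

lemma add_less_omega_pow: "x < omega_pow z \<Longrightarrow> y < omega_pow z \<Longrightarrow> x + y < omega_pow z"
proof (induction z rule: ordinal_induct)
  case zero
  then have "x = 0" "y = 0"
    by (metis omega_pow_rec(1) one_ordinal_def less_osucc_iff order.antisym zero_le_ordinal)+
  then show ?case by (simp add: ordinal_add_rec)
next
  case (succ z)
  then obtain m n where "x < omega_pow z * (osucc ^^ m) 0" "y < omega_pow z * (osucc ^^ n) 0"
    by (auto simp: omega_pow_rec less_mult_omega_iff)
  then have "x + y < omega_pow z * (osucc ^^ (n + m)) 0"
    unfolding mult_funpow_osucc_add[symmetric] by (simp add: ordinal_add_less_mono)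
  then show ?case by (auto simp: omega_pow_rec less_mult_omega_iff)
next
  case (limit z)
  then obtain v w where vw: "v < z" "x < omega_pow v" "w < z" "y < omega_pow w"
    using less_omega_pow_limit_iff by blast
  then have "x < omega_pow (max v w)" "y < omega_pow (max v w)"
    by (meson max.cobounded1 max.cobounded2 omega_pow_mono order_less_le_trans)+
  then have "x + y < omega_pow (max v w)" using limit(3) vw by simp
  then show ?case using vw less_omega_pow_limit_iff[OF limit(1,2)] by (metis max_less_iff_conj)
qed

lemma less_add_omega_pow: "x < x + omega_pow z"
  using add_less_mono_right[of 0 "omega_pow z" x] by (simp add: ordinal_add_rec)

lemma le_imp_less_add_omega_pow: "x \<le> c \<Longrightarrow> x < c + omega_pow z"
  using less_add_omega_pow order_le_less_trans by blast

text \<open>If \<open>x\<close> exceeds \<open>c\<close>, its remainder after \<open>c\<close> is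
  below the power, which absorbs \<open>y\<close> by indecomposability. This absorbs repeated
  applications of vectors.\<close>

lemma add_less_add_omega_pow:
  assumes "x < c + omega_pow z" "y < omega_pow z"
  shows "x + y < c + omega_pow z"
proof (cases "x \<le> c")
  case True
  then show ?thesis using assms(2) by (rule ordinal_add_less_mono)
next
  case False
  then obtain w where w: "x = c + w" using ordinal_le_imp_add[of c x] by (meson le_cases)
  then have "w < omega_pow z" using assms(1) add_le_mono_right by (metis not_le)
  then show ?thesis
    using add_less_omega_pow[OF _ assms(2)] w by (simp add: ordinal_add_assoc add_less_mono_right)
qed

lemma one_less_omega_pow: "0 < z \<Longrightarrow> 1 < omega_pow z"
  using omega_pow_strict_mono[of 0 z] by (simp add: omega_pow_rec)

lemma osucc_eq_add_one: "osucc x = x + 1"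
  by (simp add: one_ordinal_def ordinal_add_rec)

section \<open>Ordinal vectors\<close>

function vec_app :: "nat \<Rightarrow> (nat \<Rightarrow> ordinal) \<Rightarrow> (nat \<Rightarrow> ordinal) \<Rightarrow> nat \<Rightarrow> ordinal" where
  "vec_app m f a i =
    (if i \<le> m then max (f i) (a i) + omega_pow (vec_app m f a (Suc i)) else f i)"
  by pat_completeness auto
termination by (relation "measure (\<lambda>(m, f, a, i). Suc m - i)") auto

declare vec_app.simps [simp del]

lemma vec_app_low: "i \<le> m \<Longrightarrow>
    vec_app m f a i = max (f i) (a i) + omega_pow (vec_app m f a (Suc i))"
  and vec_app_high [simp]: "m < i \<Longrightarrow> vec_app m f a i = f i"
  by (subst vec_app.simps; simp)+

lemma fun_le_vec_app: "f i \<le> vec_app m f a i"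
  by (cases "i \<le> m")
    (simp_all add: vec_app_low le_imp_less_add_omega_pow less_imp_le)

lemma vec_app_less:
  assumes "i \<le> m"
  shows "f i < vec_app m f a i" "a i < vec_app m f a i"
  unfolding vec_app_low[OF assms] by (simp_all add: le_imp_less_add_omega_pow)

text \<open>Component \<open>i\<close> of an application is computed from component
  \<open>i + 1\<close>, starting above \<open>m\<close>; inductions on components follow this
  order.\<close>

lemma downward_induct [case_names above step]:
  assumes "\<And>i. m < i \<Longrightarrow> P i" "\<And>i. i \<le> m \<Longrightarrow> P (Suc i) \<Longrightarrow> P i"
  shows "P (i :: nat)"
proof (cases "i \<le> m")
  case True
  then show ?thesis using inc_induct[of i "Suc m" P] assms by simp
qed (simp add: assms)

lemma vec_app_mono:
  assumes "\<And>i. i \<le> N \<Longrightarrow> f i \<le> g i" "\<And>i. i \<le> m \<Longrightarrow> a i \<le> b i" "m < N"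
  shows "i \<le> N \<Longrightarrow> vec_app m f a i \<le> vec_app m g b i"
proof (induction i rule: downward_induct[of m])
  case (step i)
  then have "omega_pow (vec_app m f a (Suc i)) \<le> omega_pow (vec_app m g b (Suc i))"
    using assms(3) omega_pow_mono by simp
  then show ?case using step assms by (auto simp: vec_app_low intro!: ordinal_add_mono max.mono)
qed (simp add: assms)

text \<open>The maximum with \<open>a i\<close> may hide the increase from \<open>f i\<close> to
  \<open>g i\<close>; strictness comes from the exponent at \<open>i + 1\<close> and ultimately from
  the untouched component above \<open>m\<close>.\<close>

lemma vec_app_strict_mono:
  assumes "\<And>i. i \<le> N \<Longrightarrow> f i < g i" "m < N"
  shows "i \<le> N \<Longrightarrow> vec_app m f a i < vec_app m g a i"
proof (induction i rule: downward_induct[of m])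
  case (step i)
  then have "omega_pow (vec_app m f a (Suc i)) < omega_pow (vec_app m g a (Suc i))"
    using assms(2) omega_pow_strict_mono by simp
  then show ?case using step assms(1)[of i]
    by (auto simp: vec_app_low intro!: ordinal_add_less_mono max.mono)
qed (simp add: assms)

text \<open>
  \<open>h\<close> exceeds \<open>f\<close>, \<open>g\<close> and (see \<open>vec_app_less_dominates\<close>) the application of
  \<open>f\<close> to \<open>g\<close>; unlike these inequalities alone, the condition is stable under applying all
  three vectors to a common argument.
\<close>

definition dominates ::
  "nat \<Rightarrow> (nat \<Rightarrow> ordinal) \<Rightarrow> (nat \<Rightarrow> ordinal) \<Rightarrow> (nat \<Rightarrow> ordinal) \<Rightarrow> bool" where
  "dominates N h f g \<longleftrightarrow> (\<forall>i\<le>N. \<exists>c. f i < c + omega_pow (h (Suc i)) \<and>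
    g i < c + omega_pow (h (Suc i)) \<and> c + omega_pow (h (Suc i)) \<le> h i)"

lemma dominates_less: "dominates N h f g \<Longrightarrow> i \<le> N \<Longrightarrow> f i < h i \<and> g i < h i"
  unfolding dominates_def using order_less_le_trans by blast

text \<open>Application at the top level \<open>N\<close> gives every relevant component the
  required form, with \<open>c\<close> the maximum of the two entries.\<close>

lemma dominates_vec_app_top: "dominates N (vec_app N f g) f g"
  unfolding dominates_def
  by (auto simp: vec_app_low intro!: exI[of _ "max (f _) (g _)"] le_imp_less_add_omega_pow)

text \<open>Up to \<open>m\<close> the old \<open>c\<close> is discarded:
  \<open>max (h i) (a i)\<close> is a new one, since the powers on top of it have strictly smaller
  exponents for \<open>f\<close> and \<open>g\<close> than for \<open>h\<close>. Above
  \<open>m\<close> nothing changes.\<close>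

lemma dominates_vec_app:
  assumes dom: "dominates N h f g" and "m < N"
  shows "dominates N (vec_app m h a) (vec_app m f a) (vec_app m g a)"
  unfolding dominates_def
proof (intro allI impI)
  fix i assume "i \<le> N"
  let ?h = "vec_app m h a" and ?f = "vec_app m f a" and ?g = "vec_app m g a"
  show "\<exists>c. ?f i < c + omega_pow (?h (Suc i)) \<and>
    ?g i < c + omega_pow (?h (Suc i)) \<and> c + omega_pow (?h (Suc i)) \<le> ?h i"
  proof (cases "i \<le> m")
    case True
    have "?f (Suc i) < ?h (Suc i)" "?g (Suc i) < ?h (Suc i)"
      using True \<open>m < N\<close> dominates_less[OF dom] by (intro vec_app_strict_mono[of N]; simp)+
    moreover have "f i \<le> h i" "g i \<le> h i"
      using dominates_less[OF dom \<open>i \<le> N\<close>] by auto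
    ultimately show ?thesis
      using True
      by (auto simp: vec_app_low intro!: exI[of _ "max (h i) (a i)"] ordinal_add_less_mono
          omega_pow_strict_mono max.mono)
  next
    case False
    then show ?thesis using dom \<open>i \<le> N\<close> by (simp add: dominates_def)
  qed
qed

text \<open>By downward induction the exponent is below \<open>h (Suc i)\<close>, so adding its
  power keeps the sum below \<open>c + omega_pow (h (Suc i))\<close>.\<close>

lemma vec_app_less_dominates:
  assumes dom: "dominates N h f g" and "k < N"
  shows "i \<le> N \<Longrightarrow> vec_app k f g i < h i"
proof (induction i rule: downward_induct[of k])
  case (above i)
  then show ?case using dominates_less[OF dom] by simp
next
  case (step i)
  then have "vec_app k f g (Suc i) < h (Suc i)" using \<open>k < N\<close> by simp
  then have less: "omega_pow (vec_app k f g (Suc i)) < omega_pow (h (Suc i))"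
    by (rule omega_pow_strict_mono)
  from dom step(3) obtain c where "f i < c + omega_pow (h (Suc i))"
    "g i < c + omega_pow (h (Suc i))" and le: "c + omega_pow (h (Suc i)) \<le> h i"
    unfolding dominates_def by blast
  then have "max (f i) (g i) + omega_pow (vec_app k f g (Suc i)) < c + omega_pow (h (Suc i))"
    using less by (intro add_less_add_omega_pow) simp_all
  then show ?case using step(1) le by (simp add: vec_app_low)
qed

section \<open>Bounds on the interpretation\<close>

primrec level :: "ty \<Rightarrow> nat" where
  "level \<iota> = 0"
| "level (\<sigma> \<^bold>\<rightarrow> \<tau>) = max (Suc (level \<sigma>)) (level \<tau>)"

text \<open>A logical relation that also asserts that application is defined. Heights are compared
  with a power of omega because grafting adds heights: a strict increase of component 0 then absorbs
  the sum.\<close>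

primrec bounded :: "ty \<Rightarrow> (nat \<Rightarrow> ordinal) \<Rightarrow> val \<Rightarrow> bool" where
  "bounded \<iota> \<alpha> v \<longleftrightarrow> (\<exists>d. v = Tree d \<and> height d \<le> omega_pow (\<alpha> 0))"
| "bounded (\<sigma> \<^bold>\<rightarrow> \<tau>) \<alpha> v \<longleftrightarrow>
    (\<forall>\<beta> a. bounded \<sigma> \<beta> a \<longrightarrow> (\<exists>b. vapp v a b \<and> bounded \<tau> (vec_app (level \<sigma>) \<alpha> \<beta>) b))"

lemma bounded_mono:
  "bounded \<sigma> \<alpha> v \<Longrightarrow> (\<And>i. i \<le> level \<sigma> \<Longrightarrow> \<alpha> i \<le> \<beta> i) \<Longrightarrow> bounded \<sigma> \<beta> v"
proof (induction \<sigma> arbitrary: \<alpha> \<beta> v)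
  case Iota
  then show ?case using omega_pow_mono order_trans by fastforce
next
  case (Fun \<sigma> \<tau>)
  have "vec_app (level \<sigma>) \<alpha> \<gamma> i \<le> vec_app (level \<sigma>) \<beta> \<gamma> i" if "i \<le> level \<tau>" for \<gamma> i
    using that Fun.prems(2) by (intro vec_app_mono[of "level (\<sigma> \<^bold>\<rightarrow> \<tau>)"]) auto
  then show ?case using Fun.prems(1) Fun.IH(2) unfolding bounded.simps by meson
qed

text \<open>The grafted trees lie beneath the nodes of \<open>d\<close>, so \<open>b\<close> is the
  left summand.\<close>

lemma height_graft:
  assumes "\<And>n. height (g n) \<le> b"
  shows "height (graft d g) \<le> b + height d"
proof (induction d)
  case (Eta n)
  show ?case using assms by (simp add: ordinal_add_rec)
next
  case (Beta i \<phi>)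
  have "height (graft (\<phi> n) g) + 1 \<le> b + height (Beta i \<phi>)" for n
  proof -
    have "height (graft (\<phi> n) g) + 1 \<le> b + (height (\<phi> n) + 1)"
      unfolding ordinal_add_assoc[symmetric] by (intro add_le_mono_left Beta) simp
    also have "height (\<phi> n) + 1 \<le> height (Beta i \<phi>)" by (auto intro: cSUP_upper)
    finally show ?thesis using add_le_mono_right by blast
  qed
  then show ?case by (auto intro: cSUP_least)
qed

lemma height_graft_le_omega_pow:
  assumes "\<And>n. height (g n) \<le> omega_pow x" "height d \<le> omega_pow y" "x < z" "y < z"
  shows "height (graft d g) \<le> omega_pow z"
proof -
  have "height (graft d g) \<le> omega_pow x + height d" by (rule height_graft[OF assms(1)])
  also have "\<dots> \<le> omega_pow x + omega_pow y" using assms(2) by (rule add_le_mono_right)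
  also have "\<dots> < omega_pow z" by (intro add_less_omega_pow omega_pow_strict_mono assms)
  finally show ?thesis by simp
qed

text \<open>The strict gap between \<open>\<alpha>\<close> and \<open>\<beta>\<close> survives every
  application at function types and pays for the sum of heights at \<open>\<iota>\<close>.\<close>

lemma bounded_vgraft:
  "(\<And>n. bounded \<sigma> \<alpha> (g n)) \<Longrightarrow> (\<And>i. i \<le> level \<sigma> \<Longrightarrow> \<alpha> i < \<beta> i) \<Longrightarrow>
    height d \<le> omega_pow x \<Longrightarrow> x < \<beta> 0 \<Longrightarrow> bounded \<sigma> \<beta> (vgraft \<sigma> d g)"
proof (induction \<sigma> arbitrary: \<alpha> \<beta> g)
  case Iota
  have "height (tree_of (g n)) \<le> omega_pow (\<alpha> 0)" for n using Iota.prems(1)[of n] by auto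
  then show ?case using Iota.prems(2-4) by (auto intro: height_graft_le_omega_pow)
next
  case (Fun \<sigma> \<tau>)
  have "\<exists>b. vapp (GraftV \<tau> d g) a b \<and> bounded \<tau> (vec_app (level \<sigma>) \<beta> \<gamma>) b"
    if a: "bounded \<sigma> \<gamma> a" for \<gamma> a
  proof -
    have "\<forall>n. \<exists>b. vapp (g n) a b \<and> bounded \<tau> (vec_app (level \<sigma>) \<alpha> \<gamma>) b"
      using Fun.prems(1) a by simp
    then obtain h where h: "\<And>n. vapp (g n) a (h n)"
      "\<And>n. bounded \<tau> (vec_app (level \<sigma>) \<alpha> \<gamma>) (h n)" by metis
    have "bounded \<tau> (vec_app (level \<sigma>) \<beta> \<gamma>) (vgraft \<tau> d h)"
    proof (rule Fun.IH(2)[OF h(2) _ Fun.prems(3)])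
      show "vec_app (level \<sigma>) \<alpha> \<gamma> i < vec_app (level \<sigma>) \<beta> \<gamma> i" if "i \<le> level \<tau>" for i
        using that Fun.prems(2) by (intro vec_app_strict_mono[of "level (\<sigma> \<^bold>\<rightarrow> \<tau>)"]) auto
      show "x < vec_app (level \<sigma>) \<beta> \<gamma> 0"
        using Fun.prems(4) fun_le_vec_app order_less_le_trans by blast
    qed
    then show ?thesis using h(1) interprets_vapp.GraftV by blast
  qed
  then show ?case by simp
qed

abbreviation one_vec :: "nat \<Rightarrow> ordinal" where "one_vec \<equiv> \<lambda>_. 1"

text \<open>Covers both the successor and the generic input, which graft trees of height at most
  \<open>1 = omega_pow 0\<close>.\<close>

lemma bounded_graft_const:
  assumes "\<And>n. height (g n) \<le> 1" "\<And>d. vapp v (Tree d) (Tree (graft d g))"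
  shows "bounded (\<iota> \<^bold>\<rightarrow> \<iota>) one_vec v"
proof -
  have "height (graft d g) \<le> omega_pow (vec_app 0 one_vec \<beta> 0)"
    if "height d \<le> omega_pow (\<beta> 0)" for d \<beta>
  proof (rule height_graft_le_omega_pow[OF _ that])
    show "height (g n) \<le> omega_pow 0" for n using assms(1) by (simp add: omega_pow_rec)
    show "0 < vec_app 0 one_vec \<beta> 0"
      using vec_app_less(2)[of 0 0 "\<lambda>_. 0"] vec_app_less(1)[of 0 0 one_vec \<beta>]
      by (metis order_le_less_trans zero_le_ordinal order_refl)
  qed (simp add: vec_app_less)
  then show ?thesis using assms(2) by fastforce
qed

lemma bounded_SuccV: "bounded (\<iota> \<^bold>\<rightarrow> \<iota>) one_vec SuccV"
  by (rule bounded_graft_const[of "\<lambda>n. Eta (Suc n)"])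
    (use interprets_vapp.SuccV in \<open>simp_all add: dmap_def\<close>)

lemma bounded_GenV: "bounded (\<iota> \<^bold>\<rightarrow> \<iota>) one_vec GenV"
  by (rule bounded_graft_const[of "\<lambda>i. Beta i Eta"])
    (use interprets_vapp.GenV in \<open>simp_all add: gen_def zero_add_ordinal\<close>)

section \<open>Iteration and the recursors\<close>

lemma bounded_iterate:
  assumes w: "\<And>n. bounded (\<sigma> \<^bold>\<rightarrow> \<sigma>) \<alpha> (w n)" and a: "bounded \<sigma> \<beta> a"
  obtains v where "v 0 = a" "\<And>n. vapp (w n) (v n) (v (Suc n))"
    "\<And>n. bounded \<sigma> (vec_app (level \<sigma>) (\<lambda>i. osucc (\<alpha> i)) \<beta>) (v n)"
proof -
  text \<open>The successor makes the top component of \<open>?\<delta>\<close> strictly larger than that of \<open>\<alpha>\<close>, which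
    no number of applications of \<open>\<alpha>\<close> changes; below it, powers of \<open>\<omega>\<close> absorb sums.\<close>
  let ?l = "level \<sigma>"
  let ?\<omega> = "\<lambda>n. (vec_app ?l \<alpha> ^^ n) \<beta>" and ?\<delta> = "vec_app ?l (\<lambda>i. osucc (\<alpha> i)) \<beta>"
  \<comment> \<open>Here \<open>?\<omega> n\<close> is the vector of the \<open>n\<close>-th
    iterate. The premise stands under the existential so that choice yields a step function on all
    values, as \<open>rec_nat\<close> requires.\<close>
  have "\<forall>n x. \<exists>y. bounded \<sigma> (?\<omega> n) x \<longrightarrow> vapp (w n) x y \<and> bounded \<sigma> (?\<omega> (Suc n)) y"
    using w by auto
  then obtain s where s: "\<And>n x. bounded \<sigma> (?\<omega> n) x \<Longrightarrow>
      vapp (w n) x (s n x) \<and> bounded \<sigma> (?\<omega> (Suc n)) (s n x)" by metis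
  define v where "v = rec_nat a s"
  have v: "bounded \<sigma> (?\<omega> n) (v n)" for n
    by (induction n) (use a s in \<open>simp_all add: v_def\<close>)
  have less: "?\<omega> n i < ?\<delta> i" if "i \<le> ?l" for n i
    using that
  proof (induction n arbitrary: i)
    case 0
    then show ?case by (simp add: vec_app_less)
  next
    case (Suc n)
    \<comment> \<open>The range includes \<open>Suc ?l\<close>, the exponent of component
      \<open>?l\<close>, where \<open>\<alpha>\<close> meets its successor.\<close>
    have "i \<le> Suc ?l \<Longrightarrow> vec_app ?l \<alpha> (?\<omega> n) i < ?\<delta> i" for i
    proof (induction i rule: downward_induct[of ?l])
      case (above i)
      then show ?case by (simp add: less_osucc)
    next
      case (step i)
      let ?z = "?\<delta> (Suc i)"
      have "max (\<alpha> i) (?\<omega> n i) < max (osucc (\<alpha> i)) (\<beta> i) + omega_pow ?z"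
        using Suc.IH[OF step(1)] less_osucc[of "\<alpha> i"] step(1)
        by (auto simp: vec_app_low
            intro: le_imp_less_add_omega_pow less_imp_le le_max_iff_disj[THEN iffD2])
      moreover have "omega_pow (vec_app ?l \<alpha> (?\<omega> n) (Suc i)) < omega_pow ?z"
        using step by (intro omega_pow_strict_mono) simp
      ultimately show ?case
        unfolding vec_app_low[OF step(1)] by (rule add_less_add_omega_pow)
    qed
    then show ?case using Suc.prems by simp
  qed
  show ?thesis
  proof
    show "v 0 = a" by (simp add: v_def)
    show "vapp (w n) (v n) (v (Suc n))" for n using s[OF v[of n]] by (simp add: v_def)
    show "bounded \<sigma> ?\<delta> (v n)" for n using bounded_mono[OF v] less less_imp_le by blast
  qed
qed

text \<open>The vector after applying the recursor to \<open>f\<close> strictly exceeds the one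
  needed for all iterates of \<open>f\<close>. The application to \<open>a\<close> preserves this
  gap, which \<open>bounded_vgraft\<close> then uses to graft the iterates onto
  \<open>d\<close>.\<close>

lemma bounded_RecV:
  "bounded ((\<iota> \<^bold>\<rightarrow> \<sigma> \<^bold>\<rightarrow> \<sigma>) \<^bold>\<rightarrow> \<sigma> \<^bold>\<rightarrow> \<iota> \<^bold>\<rightarrow> \<sigma>) one_vec (RecV \<sigma>)"
proof -
  let ?l = "level \<sigma>"
  let ?r = "\<lambda>\<alpha>. vec_app (Suc ?l) one_vec \<alpha>"
  have "\<exists>b. vapp (RecV2 \<sigma> f a) (Tree d) b \<and>
      bounded \<sigma> (vec_app 0 (vec_app ?l (?r \<alpha>) \<beta>) \<delta>) b"
    if f: "bounded (\<iota> \<^bold>\<rightarrow> \<sigma> \<^bold>\<rightarrow> \<sigma>) \<alpha> f" and a: "bounded \<sigma> \<beta> a"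
      and d: "height d \<le> omega_pow (\<delta> 0)"
    for f a d \<alpha> \<beta> \<delta>
  proof -
    \<comment> \<open>The vector of \<open>f\<close> applied to a numeral: \<open>Eta n\<close> has
      height 0 and is bounded by the zero vector.\<close>
    let ?f = "vec_app 0 \<alpha> (\<lambda>_. 0)"
    have "\<exists>b. vapp f (Tree (Eta n)) b \<and> bounded (\<sigma> \<^bold>\<rightarrow> \<sigma>) ?f b" for n
    proof -
      have "bounded \<iota> (\<lambda>_. 0) (Tree (Eta n))" by simp
      then show ?thesis using f bounded.simps(2) level.simps(1) by metis
    qed
    then obtain w where w: "\<And>n. vapp f (Tree (Eta n)) (w n)"
      "\<And>n. bounded (\<sigma> \<^bold>\<rightarrow> \<sigma>) ?f (w n)" by metis
    obtain v where v: "v 0 = a" "\<And>n. vapp (w n) (v n) (v (Suc n))"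
      "\<And>n. bounded \<sigma> (vec_app ?l (\<lambda>i. osucc (?f i)) \<beta>) (v n)"
      using bounded_iterate[of \<sigma> ?f w, OF w(2) a] by blast
    \<comment> \<open>Only component 0 is changed by the numeral, and its power is smaller than that
      in \<open>?r \<alpha>\<close> because \<open>\<alpha> 1 < ?r \<alpha> 1\<close>. The successor
      is absorbed since the power \<open>omega_pow ?z\<close> exceeds 1.\<close>
    have less: "osucc (?f i) < ?r \<alpha> i" if "i \<le> Suc ?l" for i
    proof -
      let ?z = "?r \<alpha> (Suc i)"
      have "0 < ?z" using fun_le_vec_app[of one_vec "Suc i"] less_osucc[of 0]
        by (metis one_ordinal_def order_less_le_trans)
      then have one: "1 < omega_pow ?z" by (rule one_less_omega_pow)
      have "?f i < max 1 (\<alpha> i) + omega_pow ?z"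
      proof (cases i)
        case 0
        have "\<alpha> 0 + omega_pow (\<alpha> 1) < max 1 (\<alpha> 0) + omega_pow ?z"
          using 0 vec_app_less(2)[of 1 "Suc ?l" \<alpha> one_vec]
          by (intro ordinal_add_less_mono omega_pow_strict_mono) auto
        then show ?thesis using 0 by (simp add: vec_app_low max_absorb1)
      qed (simp add: le_imp_less_add_omega_pow)
      then show ?thesis
        unfolding osucc_eq_add_one vec_app_low[OF that] by (rule add_less_add_omega_pow[OF _ one])
    qed
    let ?R = "vec_app 0 (vec_app ?l (?r \<alpha>) \<beta>) \<delta>"
    have "bounded \<sigma> ?R (vgraft \<sigma> d v)"
    proof (rule bounded_vgraft[OF v(3) _ d])
      show "vec_app ?l (\<lambda>i. osucc (?f i)) \<beta> i < ?R i" if "i \<le> ?l" for i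
      proof -
        have "vec_app ?l (\<lambda>i. osucc (?f i)) \<beta> i < vec_app ?l (?r \<alpha>) \<beta> i"
          using that less by (intro vec_app_strict_mono[of "Suc ?l"]) simp_all
        then show ?thesis using fun_le_vec_app order_less_le_trans by blast
      qed
      show "\<delta> 0 < ?R 0" by (simp add: vec_app_less)
    qed
    moreover have "vapp (RecV2 \<sigma> f a) (Tree d) (vgraft \<sigma> d v)"
      using v(1,2) w(1) by (intro interprets_vapp.RecV2)
    ultimately show ?thesis by blast
  qed
  then have "bounded (\<iota> \<^bold>\<rightarrow> \<sigma>) (vec_app ?l (?r \<alpha>) \<beta>) (RecV2 \<sigma> f a)"
    if "bounded (\<iota> \<^bold>\<rightarrow> \<sigma> \<^bold>\<rightarrow> \<sigma>) \<alpha> f" "bounded \<sigma> \<beta> a" for f a \<alpha> \<beta>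
    using that by auto
  then have "bounded (\<sigma> \<^bold>\<rightarrow> \<iota> \<^bold>\<rightarrow> \<sigma>) (?r \<alpha>) (RecV1 \<sigma> f)"
    if "bounded (\<iota> \<^bold>\<rightarrow> \<sigma> \<^bold>\<rightarrow> \<sigma>) \<alpha> f" for f \<alpha>
    using that interprets_vapp.RecV1 bounded.simps(2) by metis
  moreover have "level (\<iota> \<^bold>\<rightarrow> \<sigma> \<^bold>\<rightarrow> \<sigma>) = Suc ?l" by simp
  ultimately show ?thesis
    using interprets_vapp.RecV bounded.simps(2) by metis
qed

section \<open>Vectors of terms\<close>

text \<open>With \<open>foldr\<close> the innermost variable is applied last, so extending the
  environment by an argument is an application of the vector of the abstraction.\<close>

definition env_app :: "(nat \<Rightarrow> ordinal) \<Rightarrow> (ty \<times> (nat \<Rightarrow> ordinal)) list \<Rightarrow> nat \<Rightarrow> ordinal" where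
  "env_app c es = foldr (\<lambda>(\<sigma>, e) f. vec_app (level \<sigma>) f e) es c"

lemma env_app_Nil [simp]: "env_app c [] = c"
  and env_app_Cons [simp]: "env_app c ((\<sigma>, e) # es) = vec_app (level \<sigma>) (env_app c es) e"
  by (simp_all add: env_app_def)

lemma fun_le_env_app: "c i \<le> env_app c es i"
  by (induction es) (auto intro: order_trans[OF _ fun_le_vec_app])

lemma nth_le_env_app:
  "k < length es \<Longrightarrow> i \<le> level (fst (es ! k)) \<Longrightarrow> snd (es ! k) i \<le> env_app c es i"
proof (induction es arbitrary: k)
  case (Cons e es)
  show ?case
  proof (cases k)
    case 0
    then show ?thesis using Cons.prems by (cases e) (simp add: vec_app_less less_imp_le)
  next
    case (Suc k')
    then show ?thesis
      using Cons by (cases e) (auto intro: order_trans[OF _ fun_le_vec_app])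
  qed
qed simp

lemma dominates_env_app:
  "dominates N h f g \<Longrightarrow> \<forall>e\<in>set es. level (fst e) < N \<Longrightarrow>
    dominates N (env_app h es) (env_app f es) (env_app g es)"
proof (induction es)
  case (Cons e es)
  then show ?case by (cases e) (simp add: dominates_vec_app)
qed simp

primrec term_vec :: "nat \<Rightarrow> tm \<Rightarrow> nat \<Rightarrow> ordinal" where
  "term_vec N (Var i) = one_vec"
| "term_vec N (Lam \<sigma> t) = term_vec N t"
| "term_vec N (App t u) = vec_app N (term_vec N t) (term_vec N u)"
| "term_vec N Zero = one_vec"
| "term_vec N Succ = one_vec"
| "term_vec N (Rec \<sigma>) = one_vec"

text \<open>The successor at \<open>Lam\<close> keeps environment levels strictly below
  \<open>N\<close>, as \<open>dominates_env_app\<close> requires; \<open>level \<sigma> + 2\<close>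
  is the level of the type of \<open>Rec \<sigma>\<close>.\<close>

primrec tm_level :: "tm \<Rightarrow> nat" where
  "tm_level (Var i) = 0"
| "tm_level (Lam \<sigma> t) = max (Suc (level \<sigma>)) (tm_level t)"
| "tm_level (App t u) = max (tm_level t) (tm_level u)"
| "tm_level Zero = 0"
| "tm_level Succ = 1"
| "tm_level (Rec \<sigma>) = level \<sigma> + 2"

text \<open>The type of an application has no higher level than that of its function part, so
  binders, context and constants control all levels.\<close>

lemma level_has_type:
  "has_type \<Gamma> t \<tau> \<Longrightarrow> \<forall>\<sigma>\<in>set \<Gamma>. level \<sigma> < N \<Longrightarrow> tm_level t \<le> N \<Longrightarrow> level \<tau> \<le> N"
  by (induction rule: has_type.induct) (auto simp: less_imp_le)

lemma bounded_interprets: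
  "has_type \<Gamma> t \<tau> \<Longrightarrow> \<Gamma> = map fst es \<Longrightarrow> \<forall>e\<in>set es. level (fst e) < N \<Longrightarrow>
    tm_level t \<le> N \<Longrightarrow> list_all2 (\<lambda>e v. bounded (fst e) (snd e) v) es \<gamma> \<Longrightarrow>
    \<exists>v. interprets \<gamma> t v \<and> bounded \<tau> (env_app (term_vec N t) es) v"
proof (induction arbitrary: es \<gamma> rule: has_type.induct)
  case (Var i \<Gamma>)
  then have i: "i < length es" "i < length \<gamma>" "bounded (\<Gamma> ! i) (snd (es ! i)) (\<gamma> ! i)"
    by (auto simp: list_all2_conv_all_nth)
  have "bounded (\<Gamma> ! i) (env_app one_vec es) (\<gamma> ! i)"
    by (rule bounded_mono[OF i(3)]) (use i(1) nth_le_env_app Var.prems(1) in simp)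
  then show ?case using interprets_vapp.Var[OF i(2)] by auto
next
  case (Lam \<sigma> \<Gamma> t \<tau>)
  have "\<exists>b. vapp (Clo t \<gamma>) a b \<and>
      bounded \<tau> (vec_app (level \<sigma>) (env_app (term_vec N t) es) \<beta>) b"
    if "bounded \<sigma> \<beta> a" for \<beta> a
    using Lam.IH[of "(\<sigma>, \<beta>) # es" "a # \<gamma>"] Lam.prems that
    by (auto intro: interprets_vapp.Clo)
  then show ?case
    by (intro exI[of _ "Clo t \<gamma>"]) (simp add: interprets_vapp.Lam)
next
  case (App \<Gamma> t \<sigma> \<tau> u)
  let ?f = "env_app (term_vec N t) es" and ?a = "env_app (term_vec N u) es"
  obtain f where f: "interprets \<gamma> t f" "bounded (\<sigma> \<^bold>\<rightarrow> \<tau>) ?f f"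
    using App.IH(1)[of es \<gamma>] App.prems by auto
  obtain a where a: "interprets \<gamma> u a" "bounded \<sigma> ?a a"
    using App.IH(2)[of es \<gamma>] App.prems by auto
  obtain b where b: "vapp f a b" "bounded \<tau> (vec_app (level \<sigma>) ?f ?a) b"
    using f(2) a(2) by auto
  have "level (\<sigma> \<^bold>\<rightarrow> \<tau>) \<le> N"
    using App.prems by (intro level_has_type[OF App.hyps(1)]) auto
  then have lev: "level \<sigma> < N" "level \<tau> \<le> N" by auto
  \<comment> \<open>Dominance holds for the bare vectors at level \<open>N\<close> and survives the
    environment; only then does it bound the application at the lower level of
    \<open>\<sigma>\<close>.\<close>
  have "dominates N (env_app (term_vec N (App t u)) es) ?f ?a"
    using App.prems(2) by (simp add: dominates_env_app dominates_vec_app_top)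
  then have "bounded \<tau> (env_app (term_vec N (App t u)) es) b"
    using vec_app_less_dominates[OF _ lev(1)] lev(2)
    by (intro bounded_mono[OF b(2)] less_imp_le) simp
  then show ?case using f(1) a(1) b(1) interprets_vapp.App by blast
next
  case (Zero \<Gamma>)
  show ?case by (intro exI[of _ "Tree (Eta 0)"]) (simp add: interprets_vapp.Zero)
next
  case (Succ \<Gamma>)
  show ?case
    by (intro exI[of _ SuccV] conjI interprets_vapp.Succ bounded_mono[OF bounded_SuccV])
      (use fun_le_env_app[of one_vec] in simp)
next
  case (Rec \<Gamma> \<sigma>)
  show ?case
    by (intro exI[of _ "RecV \<sigma>"] conjI interprets_vapp.Rec bounded_mono[OF bounded_RecV])
      (use fun_le_env_app[of one_vec] in simp)
qed

section \<open>Towers of exponentials\<close>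

lemma one_less_omega: "1 < omega"
  using less_omega_iff
  by (metis funpow_0 funpow_simps_right(2) comp_apply one_ordinal_def funpow.simps(2))

lemma theta_less_Suc: "theta n < theta (Suc n)"
proof (induction n)
  case 0
  \<comment> \<open>Otherwise \<open>omega_pow 1\<close> would be a finite \<open>n\<close>, but it
    equals \<open>1 * omega\<close>, which exceeds \<open>1 * (n + 1) = n + 1\<close>.\<close>
  have "omega \<le> omega_pow 1"
  proof (rule ccontr)
    assume "\<not> omega \<le> omega_pow 1"
    then obtain n where n: "omega_pow 1 = (osucc ^^ n) 0" by (auto simp: not_le less_omega_iff)
    have mult: "1 * (osucc ^^ k) 0 = (osucc ^^ k) 0" for k
      by (induction k) (simp_all add: ordinal_mult_rec flip: osucc_eq_add_one)
    have "omega_pow 1 < 1 * (osucc ^^ Suc n) 0" unfolding mult n by (simp add: less_osucc)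
    then have "omega_pow 1 < 1 * omega" using less_mult_omega_iff by blast
    then show False using omega_pow_rec(2)[of 0] by (simp add: omega_pow_rec(1) one_ordinal_def)
  qed
  then show ?case using omega_pow_strict_mono[OF one_less_omega] by simp
next
  case (Suc n)
  then show ?case using omega_pow_strict_mono by simp
qed

lemma theta_mono: "m \<le> n \<Longrightarrow> theta m \<le> theta n"
  by (rule lift_Suc_mono_le) (rule less_imp_le[OF theta_less_Suc])

lemma theta_less_epsilon_0: "theta n < epsilon_0"
proof -
  have "theta (Suc n) \<le> epsilon_0" unfolding epsilon_0_def by (intro cSUP_upper) auto
  then show ?thesis using theta_less_Suc order_less_le_trans by blast
qed

text \<open>Up to \<open>m\<close>, the bound is the power of the bound for component
  \<open>i + 1\<close>, hence closed under the sum. Beyond \<open>N\<close> the truncated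
  subtraction makes it \<open>theta 0\<close>.\<close>

lemma vec_app_less_theta:
  assumes "\<And>i. f i < theta (Suc N - i)" "\<And>i. a i < theta (Suc N - i)" "m \<le> N"
  shows "vec_app m f a i < theta (Suc N - i)"
proof (induction i rule: downward_induct[of m])
  case (step i)
  then have i: "Suc N - i = Suc (N - i)" using assms(3) by simp
  show ?case
    unfolding vec_app_low[OF step(1)] i theta.simps
  proof (rule add_less_omega_pow)
    show "max (f i) (a i) < omega_pow (theta (N - i))"
      using assms(1,2)[of i] i by simp
    show "omega_pow (vec_app m f a (Suc i)) < omega_pow (theta (N - i))"
      using step(2) by (intro omega_pow_strict_mono) simp
  qed
qed (simp add: assms)

lemma one_less_theta: "1 < theta n"
  using one_less_omega theta_mono[of 0 n] by simp

lemma term_vec_less_theta: "term_vec N t i < theta (Suc N - i)"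
  by (induction t arbitrary: i) (simp_all add: one_less_theta vec_app_less_theta)

section \<open>Type levels, codes and the final bound\<close>

lemma level_le_ty_code: "level \<sigma> \<le> ty_code \<sigma>"
proof (induction \<sigma>)
  case (Fun \<sigma> \<tau>)
  then show ?case
    using le_prod_encode_1[of "ty_code \<sigma>" "ty_code \<tau>"] le_prod_encode_2[of "ty_code \<tau>" "ty_code \<sigma>"]
    by simp
qed simp

lemma add_le_prod_encode: "a + b \<le> prod_encode (a, b)"
  by (cases "a + b") (simp_all add: prod_encode_def)

text \<open>The constructor tags in the code pay for the constants in \<open>tm_level\<close>: 1 for
  \<open>Lam\<close>, 4 for \<open>Succ\<close>, 5 for \<open>Rec\<close>.\<close>

lemma tm_level_le_tm_code: "tm_level t \<le> tm_code t"
proof (induction t)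
  case (Lam \<sigma> t)
  then show ?case
    using add_le_prod_encode[of 1 "prod_encode (ty_code \<sigma>, tm_code t)"]
      add_le_prod_encode[of "ty_code \<sigma>" "tm_code t"] level_le_ty_code[of \<sigma>] by simp
next
  case (App t u)
  then show ?case
    using add_le_prod_encode[of 2 "prod_encode (tm_code t, tm_code u)"]
      add_le_prod_encode[of "tm_code t" "tm_code u"] by simp
next
  case (Rec \<sigma>)
  then show ?case
    using add_le_prod_encode[of 5 "ty_code \<sigma>"] level_le_ty_code[of \<sigma>] by simp
qed (use add_le_prod_encode[of 4 0] in simp_all)

text \<open>Applying the vector to that of the generic input, at level 1, stays below
  \<open>theta (N + 1)\<close> in component 0; the power in \<open>bounded\<close> costs one more
  exponential.\<close>

lemma height_dialogue_tree:
  assumes t: "t \<in> closed_functionals" and N: "tm_level t \<le> N" "1 \<le> N"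
  shows "height (dialogue_tree t) < theta (N + 2)"
proof -
  let ?x = "vec_app 1 (term_vec N t) one_vec"
  obtain f where f: "interprets [] t f" "bounded ((\<iota> \<^bold>\<rightarrow> \<iota>) \<^bold>\<rightarrow> \<iota>) (term_vec N t) f"
    using bounded_interprets[of "[]" t "(\<iota> \<^bold>\<rightarrow> \<iota>) \<^bold>\<rightarrow> \<iota>" "[]" N "[]"] t N(1)
    unfolding closed_functionals_def env_app_Nil by auto
  have "level (\<iota> \<^bold>\<rightarrow> \<iota>) = 1" by simp
  then obtain d where d: "vapp f GenV (Tree d)" "height d \<le> omega_pow (?x 0)"
    using f(2) bounded_GenV by (metis bounded.simps)
  have "dialogue_tree t = d"
    using f(1) d(1) by (intro dialogue_tree_eqI) (auto simp: has_dialogue_tree_def)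
  moreover have "?x 0 < theta (Suc N - 0)"
    using N by (intro vec_app_less_theta term_vec_less_theta one_less_theta)
  then have "omega_pow (?x 0) < theta (N + 2)"
    using omega_pow_strict_mono by (simp add: numeral_2_eq_2)
  ultimately show ?thesis using d(2) by simp
qed

lemma computable_on_add_3: "computable_on A (\<lambda>t. tm_code t + 3)"
proof -
  let ?S = "\<lambda>f. RComp RSucc [f]"
  have S: "evaluates (?S f) xs (Suc y)" if "evaluates f xs y" for f xs y
    using that by (intro evaluates.RComp[of xs "[f]" "[y]"] evaluates.RSucc) simp
  have "evaluates (?S (?S (?S (RProj 0)))) [n] (n + 3)" for n
    using S[OF S[OF S[OF evaluates.RProj[of 0 "[n]"]]]] by (simp add: numeral_3_eq_3)
  then show ?thesis unfolding computable_on_def by blast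
qed

theorem theorem1:
  "\<exists>K :: tm \<Rightarrow> nat. computable_on closed_functionals K \<and>
    (\<forall>t\<in>closed_functionals.
      2 \<le> K t \<and> height (dialogue_tree t) < theta (K t) \<and> theta (K t) < epsilon_0)"
proof (intro exI conjI ballI)
  \<comment> \<open>The value is \<open>N + 2\<close> for \<open>N = tm_code t + 1\<close>, which is
    at least 1 and at least \<open>tm_level t\<close>.\<close>
  show "computable_on closed_functionals (\<lambda>t. tm_code t + 3)" by (rule computable_on_add_3)
next
  fix t assume "t \<in> closed_functionals"
  then show "height (dialogue_tree t) < theta (tm_code t + 3)"
    using height_dialogue_tree[of t "tm_code t + 1"] tm_level_le_tm_code[of t]
    by (simp add: numeral_3_eq_3)
qed (simp_all add: theta_less_epsilon_0)

end
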